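(* Let $n,k\ge 1$. If a diagram $D'$ is obtained from a diagram $D\in TL_n$ by a $k$-move, then $$[k]\,\operatorname{coeff}_{\in f^{(n)}}(D) = \operatorname{coeff}_{\in f^{(n)}}(D').$$
   Context: Quantum integers: $[n] = \frac{q^n-q^{-n}}{q-q^{-1}}$, with $q$ a formal parameter. Temperley-Lieb algebra: an $n$ strand Temperley-Lieb diagram is an isotopy class of planar diagrams in a rectangle with $n$ marked points on the upper edge and $n$ on the lower edge (each numbered $1,\dots,n$ from left to right), consisting of non-intersecting arcs joining these $2n$ points in pairs. $TL_n$ is the algebra over $\mathbb{C}(q)$ with basis the $n$ strand diagrams, and product given by stacking, each closed loop being removed and replaced by a factor $-[2]$. $e_i$ ($1\le i\le n-1$) is the diagram joining upper points $i,i+1$ to each other, lower points $i,i+1$ to each other, with all other strands vertical. Jones-Wenzl idempotent: $f^{(n)} \in TL_n$ is the unique element with $f^{(n)}\neq 0$, $f^{(n)}f^{(n)}=f^{(n)}$, and $e_i f^{(n)} = f^{(n)} e_i = 0$ for all $i\in\{1,\dots,n-1\}$. $\operatorname{coeff}_{\in f^{(n)}}(D)$ is the coefficient of $D$ when $f^{(n)}$ is expanded in the diagram basis. Capform: the capform of $D$ is obtained by folding the upper edge down to the right, giving $n$ non-crossing caps on $2n$ points on a line, numbered $1,\dots,2n$ from left to right: lower point $j$ of $D$ becomes point $j$, and upper point $j$ of $D$ becomes point $2n+1-j$. This is a bijection between $n$ strand diagrams and non-crossing perfect matchings of $\{1,\dots,2n\}$. $k$-move: it acts on the capform of a diagram,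 transforming a collection of $k$ nested caps with centre strictly in the left half of the capform into $k-1$ nested caps to the right of a single cap, leaving the rest of the diagram unchanged. Explicitly: the capform of $D$ contains, for some $a\ge 1$, the $k$ nested caps joining $a+j$ to $a+2k-1-j$ for $j=0,\dots,k-1$ (occupying the consecutive points $a,\dots,a+2k-1$), with $a+k\le n$ (the centre, $a+k-\frac12$, is strictly to the left of the middle, $n+\frac12$); the capform of $D'$ is the same except that these caps are replaced by the single cap joining $a$ to $a+1$ and the $k-1$ nested caps joining $a+2+j$ to $a+2k-1-j$ for $j=0,\dots,k-2$. *)

theory Defs
  imports
    "HOL-Library.Disjoint_Sets"
    "HOL-Computational_Algebra.Fraction_Field"
    "HOL-Computational_Algebra.Polynomial"
begin

section \<open>Quantum integers\<close>

type_synonym ratfun = "complex poly fract"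

definition qvar :: ratfun
  where "qvar = Fraction_Field.Fract [:0, 1:] 1"

definition qint :: "nat \<Rightarrow> ratfun"
  where "qint n = (qvar ^ n - inverse qvar ^ n) / (qvar - inverse qvar)"


section \<open>Temperley--Lieb diagrams\<close>

text \<open>
  The isotopy class of a planar diagram is determined by which marked points its arcs join,
  so a diagram is represented by the set of its arcs, each arc being the two-element set of
  its end points.
\<close>

datatype pt = Upper nat | Lower nat

type_synonym diagram = "pt set set"

definition points :: "nat \<Rightarrow> pt set"
  where "points n = Upper ` {1..n} \<union> Lower ` {1..n}"

definition perfect_matching :: "'a set \<Rightarrow> 'a set set \<Rightarrow> bool"
  where "perfect_matching A M \<longleftrightarrow> partition_on A M \<and> (\<forall>c\<in>M. card c = 2)"

definition noncrossing :: "nat set set \<Rightarrow> bool"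
  where "noncrossing M \<longleftrightarrow>
    \<not> (\<exists>a b c d. a < b \<and> b < c \<and> c < d \<and> {a, c} \<in> M \<and> {b, d} \<in> M)"

fun fold_pt :: "nat \<Rightarrow> pt \<Rightarrow> nat" where
  "fold_pt n (Lower j) = j"
| "fold_pt n (Upper j) = 2 * n + 1 - j"

definition capform :: "nat \<Rightarrow> diagram \<Rightarrow> nat set set"
  where "capform n D = (\<lambda>c. fold_pt n ` c) ` D"

text \<open>
  \<^const>\<open>fold_pt\<close> numbers the marked points in the order in which they are met when going once
  around the boundary of the rectangle, so arcs inside the rectangle can be drawn disjointly
  exactly if the capform is non-crossing.
\<close>

definition tl_diagrams :: "nat \<Rightarrow> diagram set"
  where "tl_diagrams n = {D. perfect_matching (points n) D \<and> noncrossing (capform n D)}"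


section \<open>Stacking\<close>

text \<open>
  \<open>D\<close> is put on top of \<open>E\<close>: the lower points of \<open>D\<close> are identified with the upper points of
  \<open>E\<close>, and the resulting points are the ones called \<open>Mid\<close>.
\<close>

datatype stack_pt = Top nat | Mid nat | Bot nat

fun upper_half :: "pt \<Rightarrow> stack_pt" where
  "upper_half (Upper j) = Top j"
| "upper_half (Lower j) = Mid j"

fun lower_half :: "pt \<Rightarrow> stack_pt" where
  "lower_half (Upper j) = Mid j"
| "lower_half (Lower j) = Bot j"

fun outer :: "pt \<Rightarrow> stack_pt" where
  "outer (Upper j) = Top j"
| "outer (Lower j) = Bot j"

definition stack_arcs :: "diagram \<Rightarrow> diagram \<Rightarrow> stack_pt rel"
  where "stack_arcs D E =
    {(u, v). {u, v} \<in> (\<lambda>c. upper_half ` c) ` D \<union> (\<lambda>c. lower_half ` c) ` E}"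

definition stack :: "diagram \<Rightarrow> diagram \<Rightarrow> diagram"
  where "stack D E = {{x, y} | x y. x \<noteq> y \<and> (outer x, outer y) \<in> (stack_arcs D E)\<^sup>*}"

text \<open>
  A closed loop is a connected component of the stacked picture that does not reach the upper
  or the lower edge.
\<close>

definition loops :: "nat \<Rightarrow> diagram \<Rightarrow> diagram \<Rightarrow> nat"
  where "loops n D E =
    card {C. (\<exists>m\<in>{1..n}. C = (stack_arcs D E)\<^sup>* `` {Mid m}) \<and> C \<subseteq> range Mid}"


section \<open>The Temperley--Lieb algebra\<close>

text \<open>
  An element is represented by its coefficient function: \<open>x D\<close> is the coefficient of the
  diagram \<open>D\<close> in \<open>x\<close>.
\<close>

type_synonym tl = "diagram \<Rightarrow> ratfun"

definition tl_carrier :: "nat \<Rightarrow> tl set"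
  where "tl_carrier n = {x. \<forall>D. D \<notin> tl_diagrams n \<longrightarrow> x D = 0}"

definition basis :: "diagram \<Rightarrow> tl"
  where "basis D = (\<lambda>F. if F = D then 1 else 0)"

definition tl_mult :: "nat \<Rightarrow> tl \<Rightarrow> tl \<Rightarrow> tl"
  where "tl_mult n x y = (\<lambda>F. \<Sum>D\<in>tl_diagrams n. \<Sum>E\<in>tl_diagrams n.
    x D * y E * (- qint 2) ^ loops n D E * basis (stack D E) F)"

definition e_diagram :: "nat \<Rightarrow> nat \<Rightarrow> diagram"
  where "e_diagram n i =
    {{Upper i, Upper (i + 1)}, {Lower i, Lower (i + 1)}}
    \<union> {{Upper j, Lower j} | j. j \<in> {1..n} - {i, i + 1}}"

definition jones_wenzl :: "nat \<Rightarrow> tl"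
  where "jones_wenzl n = (THE f. f \<in> tl_carrier n \<and> f \<noteq> (\<lambda>_. 0) \<and> tl_mult n f f = f \<and>
    (\<forall>i. 1 \<le> i \<and> i \<le> n - 1 \<longrightarrow>
      tl_mult n (basis (e_diagram n i)) f = (\<lambda>_. 0) \<and>
      tl_mult n f (basis (e_diagram n i)) = (\<lambda>_. 0)))"


section \<open>Moves on capforms\<close>

definition nested_caps :: "nat \<Rightarrow> nat \<Rightarrow> nat set set"
  where "nested_caps a k = {{a + j, a + 2 * k - 1 - j} | j. j < k}"

text \<open>
  \<open>a + k \<le> n\<close> says that the centre \<open>a + k - 1/2\<close> of the nested caps lies strictly to the left
  of the middle \<open>n + 1/2\<close> of the capform.
\<close>

definition k_move :: "nat \<Rightarrow> nat \<Rightarrow> diagram \<Rightarrow> diagram \<Rightarrow> bool"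
  where "k_move n k D D' \<longleftrightarrow> (\<exists>a\<ge>1. a + k \<le> n \<and>
    nested_caps a k \<subseteq> capform n D \<and>
    capform n D' =
      (capform n D - nested_caps a k) \<union> ({{a, a + 1}} \<union> nested_caps (a + 2) (k - 1)))"

end

theory Submission
  imports Defs "HOL-Computational_Algebra.Polynomial_Factorial"
begin

text \<open>
  For diagrams \<open>D\<close>, \<open>E\<close> let \<open>c(D, E)\<close> be the number of components of the union of their arcs on
  the \<open>2n\<close> marked points. Since \<open>c(D, E) < c(D, D)\<close> for \<open>D \<noteq> E\<close> and \<open>-[2]\<close> has positive degree in
  \<open>q\<close>, the form \<open>(-[2])^c(D, E)\<close> is nondegenerate on the span of any set of diagrams: look at the
  coefficient of largest degree. Capping off the lower points \<open>i\<close>, \<open>i + 1\<close> (multiplication by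
  \<open>e_i\<close>) is self-adjoint for this form, and every diagram other than the identity contains a cap
  at adjacent lower points. Hence the elements killed by all \<open>e_i\<close> on the right are those
  orthogonal to all non-identity diagrams; they form a line, invariant under the reflection in
  a horizontal axis, and the normalization with identity coefficient \<open>1\<close> is \<open>f\<close>.

  Let \<open>N\<^sub>j\<close> be the diagram in which the \<open>k\<close> nested caps of \<open>D\<close> are replaced by \<open>j\<close> nested caps
  over a single cap followed by \<open>k - 1 - j\<close> nested caps, so that \<open>N\<^sub>0 = D'\<close> and \<open>N\<^sub>k\<^sub>-\<^sub>1 = D\<close>. The
  coefficient of \<open>N\<^sub>j\<close> in \<open>f e_i = 0\<close>, where \<open>i\<close> is the position of the single cap, reads
  \<open>[2] f(N\<^sub>j) = f(N\<^sub>j\<^sub>-\<^sub>1) + f(N\<^sub>j\<^sub>+\<^sub>1)\<close>, without the last term if \<open>j = k - 1\<close>. This is the recursion of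
  the quantum integers.
\<close>


section \<open>Perfect matchings and connectivity\<close>

text \<open>\<open>jones_wenzl\<close> is a definite description, so nothing is known about its
  coefficients before existence and uniqueness are settled. Arguing with the form achieves this
  without associativity of \<open>tl_mult\<close> and without Wenzl's recursion: every fact needed
  about products describes what happens to a picture when the arcs at two adjacent points are
  exchanged for a cap and the join of their other ends (\<open>rewire\<close>). A single count of
  components, in the locale \<open>rewired\<close>, serves both for closed loops of stacked pictures
  and for the form. Existence is a dimension count: orthogonality to the non-identity diagrams is
  one equation fewer than there are coefficients. Nondegeneracy on the span of the non-identity
  diagrams makes the identity coefficient of a nonzero solution nonzero, hence normalizable. In the
  recursion, \<open>a + k \<le> n\<close> enters because every single cap must sit at two lower
  points, where \<open>e_i\<close> acts.\<close>

lemma perfect_matching_unique: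
  assumes "perfect_matching A M" "c \<in> M" "d \<in> M" "x \<in> c" "x \<in> d"
  shows "c = d"
  using assms unfolding perfect_matching_def partition_on_def disjoint_def by blast

lemma perfect_matching_subset: "perfect_matching A M \<Longrightarrow> c \<in> M \<Longrightarrow> c \<subseteq> A"
  unfolding perfect_matching_def partition_on_def by blast

lemma perfect_matching_pair:
  assumes "perfect_matching A M" "c \<in> M"
  obtains x y where "c = {x, y}" "x \<noteq> y"
  using assms unfolding perfect_matching_def by (meson card_2_iff)

lemma perfect_matching_mate:
  assumes "perfect_matching A M" "x \<in> A"
  obtains y where "{x, y} \<in> M" "y \<noteq> x" "y \<in> A"
proof -
  obtain c where c: "c \<in> M" "x \<in> c"
    using assms unfolding perfect_matching_def partition_on_def by blast
  obtain u v where uv: "c = {u, v}" "u \<noteq> v"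
    using perfect_matching_pair[OF assms(1) c(1)] .
  then have "{x, if x = u then v else u} \<in> M" "(if x = u then v else u) \<noteq> x"
    using c by (auto simp: insert_commute)
  moreover from this(1) have "(if x = u then v else u) \<in> A"
    using perfect_matching_subset[OF assms(1)] by blast
  ultimately show ?thesis using that by blast
qed

lemma perfect_matching_mate_eq:
  assumes "perfect_matching A M" "{x, y} \<in> M" "{x, z} \<in> M"
  shows "y = z"
  using perfect_matching_unique[OF assms, of x] by (auto simp: doubleton_eq_iff)

lemma perfect_matching_neq:
  assumes "perfect_matching A M" "{x, y} \<in> M" shows "x \<noteq> y"
  using assms unfolding perfect_matching_def by fastforce

lemma perfect_matchingI:
  assumes "\<And>c. c \<in> M \<Longrightarrow> c \<subseteq> A \<and> card c = 2"
    and "\<And>x. x \<in> A \<Longrightarrow> \<exists>c\<in>M. x \<in> c"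
    and "\<And>c d x. c \<in> M \<Longrightarrow> d \<in> M \<Longrightarrow> x \<in> c \<Longrightarrow> x \<in> d \<Longrightarrow> c = d"
  shows "perfect_matching A M"
  unfolding perfect_matching_def partition_on_def disjoint_def
proof (intro conjI ballI impI)
  show "\<Union> M = A" using assms(1,2) by blast
  show "{} \<notin> M" using assms(1) by force
  show "c \<inter> d = {}" if "c \<in> M" "d \<in> M" "c \<noteq> d" for c d
    using assms(3) that by blast
  show "card c = 2" if "c \<in> M" for c using assms(1) that by blast
qed

lemma perfect_matching_insert:
  assumes "perfect_matching A M" "x \<notin> A" "y \<notin> A" "x \<noteq> y"
  shows "perfect_matching (insert x (insert y A)) (insert {x, y} M)"
proof (rule perfect_matchingI)
  show "c \<subseteq> insert x (insert y A) \<and> card c = 2" if "c \<in> insert {x, y} M" for c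
    using that assms perfect_matching_subset[OF assms(1)] unfolding perfect_matching_def by auto
  show "\<exists>c\<in>insert {x, y} M. z \<in> c" if "z \<in> insert x (insert y A)" for z
  proof (cases "z \<in> A")
    case True
    then obtain w where "{z, w} \<in> M" using perfect_matching_mate[OF assms(1)] by metis
    then show ?thesis by blast
  qed (use that in blast)
  show "c = d" if "c \<in> insert {x, y} M" "d \<in> insert {x, y} M" "z \<in> c" "z \<in> d" for c d z
    using that perfect_matching_unique[OF assms(1), of c d z] perfect_matching_subset[OF assms(1)]
      assms(2,3) by blast
qed

lemma perfect_matching_remove:
  assumes "perfect_matching A M" "{x, y} \<in> M"
  shows "perfect_matching (A - {x, y}) (M - {{x, y}})"
proof (rule perfect_matchingI)
  show "c \<subseteq> A - {x, y} \<and> card c = 2" if "c \<in> M - {{x, y}}" for c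
    using that perfect_matching_subset[OF assms(1), of c]
      perfect_matching_unique[OF assms(1), of c "{x, y}"] assms
    unfolding perfect_matching_def by blast
  show "\<exists>c\<in>M - {{x, y}}. z \<in> c" if "z \<in> A - {x, y}" for z
    using that perfect_matching_mate[OF assms(1), of z] by (metis Diff_iff empty_iff insert_iff)
  show "c = d" if "c \<in> M - {{x, y}}" "d \<in> M - {{x, y}}" "z \<in> c" "z \<in> d" for c d z
    using that perfect_matching_unique[OF assms(1), of c d z] by blast
qed

lemma perfect_matching_subset_eq:
  assumes "perfect_matching A M" "perfect_matching A N" "N \<subseteq> M"
  shows "N = M"
proof
  show "M \<subseteq> N"
  proof
    fix c assume c: "c \<in> M"
    obtain x y where xy: "c = {x, y}" using perfect_matching_pair[OF assms(1) c] by blast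
    then have "x \<in> A" using perfect_matching_subset[OF assms(1) c] by blast
    then obtain z where "{x, z} \<in> N" using perfect_matching_mate[OF assms(2)] by blast
    then show "c \<in> N" using perfect_matching_unique[OF assms(1) c, of "{x, z}" x] assms(3) xy by auto
  qed
qed (rule assms(3))

lemma perfect_matching_image:
  assumes "perfect_matching A M" "inj_on f A"
  shows "perfect_matching (f ` A) ((`) f ` M)"
proof (rule perfect_matchingI)
  fix c assume "c \<in> (`) f ` M"
  then obtain d where d: "d \<in> M" "c = f ` d" by blast
  have "d \<subseteq> A" using perfect_matching_subset[OF assms(1) d(1)] .
  moreover from this have "card (f ` d) = card d" by (intro card_image inj_on_subset[OF assms(2)])
  ultimately show "c \<subseteq> f ` A \<and> card c = 2"
    using d assms(1) unfolding perfect_matching_def by auto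
next
  fix x assume "x \<in> f ` A"
  then obtain z where z: "z \<in> A" "x = f z" by blast
  then obtain y where "{z, y} \<in> M" using perfect_matching_mate[OF assms(1)] by metis
  from imageI[OF this, of "(`) f"] show "\<exists>c\<in>(`) f ` M. x \<in> c" using z by auto
next
  fix c d x assume *: "c \<in> (`) f ` M" "d \<in> (`) f ` M" "x \<in> c" "x \<in> d"
  then obtain c' d' u v where **: "c' \<in> M" "d' \<in> M" "c = f ` c'" "d = f ` d'"
    "u \<in> c'" "v \<in> d'" "x = f u" "x = f v" by blast
  then have "u = v" using assms(2) perfect_matching_subset[OF assms(1)]
    by (metis inj_onD subsetD)
  then show "c = d" using ** perfect_matching_unique[OF assms(1)] by metis
qed

text \<open>The effect of \<open>e_i\<close> placed below a diagram, when \<open>p\<close> and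
  \<open>r\<close> are the lower points \<open>i\<close> and \<open>i + 1\<close>. One formula
  covers both cases: if \<open>p\<close> and \<open>r\<close> are partners, nothing is left over and
  the empty set is discarded; otherwise the two leftover ends form a new arc.\<close>

definition rewire :: "'a \<Rightarrow> 'a \<Rightarrow> 'a set set \<Rightarrow> 'a set set" where
  "rewire p r M = insert {p, r} ({c \<in> M. p \<notin> c \<and> r \<notin> c} \<union>
     ({\<Union>{c \<in> M. p \<in> c \<or> r \<in> c} - {p, r}} - {{}}))"

lemma rewire_arc:
  assumes "perfect_matching A M" "{p, r} \<in> M"
  shows "rewire p r M = M"
proof -
  have "{c \<in> M. p \<in> c \<or> r \<in> c} = {{p, r}}"
    using assms perfect_matching_unique[OF assms(1) _ assms(2)] by blast
  then show ?thesis unfolding rewire_def using assms(2) by auto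
qed

lemma rewire_two_arcs:
  assumes "\<forall>c\<in>M. c \<inter> {p, r, x, y} = {}" "x \<notin> {p, r}" "y \<notin> {p, r}" "p \<noteq> r"
  shows "rewire p r (insert {p, x} (insert {r, y} M)) = insert {p, r} (insert {x, y} M)"
proof -
  have "{c \<in> insert {p, x} (insert {r, y} M). p \<in> c \<or> r \<in> c} = {{p, x}, {r, y}}"
    using assms(1) by blast
  moreover have "{c \<in> insert {p, x} (insert {r, y} M). p \<notin> c \<and> r \<notin> c} = M"
    using assms(1) by blast
  moreover have "\<Union>{{p, x}, {r, y}} - {p, r} = {x, y}" using assms by auto
  ultimately show ?thesis unfolding rewire_def by auto
qed

text \<open>Normal form for points that are not partners: \<open>rewire\<close> becomes an exchange
  of two inserted arcs, with \<open>M0\<close> disjoint from everything that changes.\<close>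

lemma perfect_matching_two_arcs:
  assumes "perfect_matching A M" "p \<in> A" "r \<in> A" "p \<noteq> r" "{p, r} \<notin> M"
  obtains x y M0 where "x \<noteq> y" "x \<notin> {p, r}" "y \<notin> {p, r}" "x \<in> A" "y \<in> A"
    "M = insert {p, x} (insert {r, y} M0)" "perfect_matching (A - {p, r, x, y}) M0"
    "\<forall>c\<in>M0. c \<inter> {p, r, x, y} = {}"
    "rewire p r M = insert {p, r} (insert {x, y} M0)"
proof -
  obtain x where x: "{p, x} \<in> M" "x \<noteq> p" "x \<in> A" using perfect_matching_mate[OF assms(1,2)] .
  obtain y where y: "{r, y} \<in> M" "y \<noteq> r" "y \<in> A" using perfect_matching_mate[OF assms(1,3)] .
  have xr: "x \<noteq> r" "y \<noteq> p" using x y assms(5) by (auto simp: insert_commute)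
  have xy: "x \<noteq> y"
    using perfect_matching_unique[OF assms(1) x(1) y(1), of x] assms(4) x by (auto simp: doubleton_eq_iff)
  define M0 where "M0 = M - {{p, x}} - {{r, y}}"
  have ne: "{p, x} \<noteq> {r, y}" using assms(4) xr by (auto simp: doubleton_eq_iff)
  have M: "M = insert {p, x} (insert {r, y} M0)" unfolding M0_def using x y by blast
  have "perfect_matching (A - {p, x} - {r, y}) M0"
    unfolding M0_def using perfect_matching_remove[OF perfect_matching_remove[OF assms(1) x(1)]] y ne by blast
  moreover have "A - {p, x} - {r, y} = A - {p, r, x, y}" by blast
  ultimately have pm: "perfect_matching (A - {p, r, x, y}) M0" by simp
  then have dis: "\<forall>c\<in>M0. c \<inter> {p, r, x, y} = {}" using perfect_matching_subset by fastforce
  have "rewire p r M = insert {p, r} (insert {x, y} M0)"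
    unfolding M by (rule rewire_two_arcs) (use dis x y xr assms in auto)
  then show ?thesis using that[of x y M0] xy x y xr M pm dis by blast
qed

lemma perfect_matching_rewire:
  assumes "perfect_matching A M" "p \<in> A" "r \<in> A" "p \<noteq> r"
  shows "perfect_matching A (rewire p r M)"
proof (cases "{p, r} \<in> M")
  case True
  then show ?thesis using rewire_arc assms by metis
next
  case False
  obtain x y M0 where *: "x \<noteq> y" "x \<notin> {p, r}" "y \<notin> {p, r}" "x \<in> A" "y \<in> A"
    "perfect_matching (A - {p, r, x, y}) M0" "rewire p r M = insert {p, r} (insert {x, y} M0)"
    using perfect_matching_two_arcs[OF assms False] by metis
  have "perfect_matching (insert p (insert r (insert x (insert y (A - {p, r, x, y})))))
      (insert {p, r} (insert {x, y} M0))"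
    by (intro perfect_matching_insert) (use * assms in auto)
  moreover have "insert p (insert r (insert x (insert y (A - {p, r, x, y})))) = A"
    using * assms by blast
  ultimately show ?thesis using * by simp
qed

lemma arc_in_rewire: "{p, r} \<in> rewire p r M"
  unfolding rewire_def by simp

lemma rewire_image:
  assumes "perfect_matching A M" "p \<in> A" "r \<in> A" "p \<noteq> r" "inj_on f A"
  shows "(`) f ` rewire p r M = rewire (f p) (f r) ((`) f ` M)"
proof (cases "{p, r} \<in> M")
  case True
  from imageI[OF this, of "(`) f"] have "{f p, f r} \<in> (`) f ` M" by simp
  then show ?thesis
    using rewire_arc[OF assms(1) True] rewire_arc[OF perfect_matching_image[OF assms(1,5)]] by metis
next
  case False
  obtain x y M0 where *: "x \<noteq> y" "x \<notin> {p, r}" "y \<notin> {p, r}" "x \<in> A" "y \<in> A"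
    "M = insert {p, x} (insert {r, y} M0)" "perfect_matching (A - {p, r, x, y}) M0"
    "rewire p r M = insert {p, r} (insert {x, y} M0)"
    using perfect_matching_two_arcs[OF assms(1-4) False] by metis
  have ne: "f x \<notin> {f p, f r}" "f y \<notin> {f p, f r}" "f p \<noteq> f r"
    using * assms inj_on_eq_iff[OF assms(5)] by auto
  have "f ` c \<inter> {f p, f r, f x, f y} = {}" if "c \<in> M0" for c
  proof -
    have "c \<subseteq> A - {p, r, x, y}" using perfect_matching_subset[OF *(7) that] .
    then have "f ` c \<inter> f ` {p, r, x, y} = {}"
      using inj_on_image_Int[OF assms(5), of c "{p, r, x, y}"] * assms by auto
    then show ?thesis by simp
  qed
  then have "rewire (f p) (f r) (insert {f p, f x} (insert {f r, f y} ((`) f ` M0)))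
      = insert {f p, f r} (insert {f x, f y} ((`) f ` M0))"
    by (intro rewire_two_arcs) (use ne in auto)
  then show ?thesis using * by simp
qed

section \<open>Connected components of a set of arcs\<close>

definition adjacency :: "'a set set \<Rightarrow> 'a rel" where
  "adjacency H = {(u, v). {u, v} \<in> H}"

abbreviation component :: "'a set set \<Rightarrow> 'a \<Rightarrow> 'a set" where
  "component H v \<equiv> (adjacency H)\<^sup>* `` {v}"

lemma adjacency_sym: "sym (adjacency H)"
  unfolding adjacency_def sym_def by (auto simp: insert_commute)

lemma reach_sym: "(u, v) \<in> (adjacency H)\<^sup>* \<Longrightarrow> (v, u) \<in> (adjacency H)\<^sup>*"
  using sym_rtrancl[OF adjacency_sym] by (meson symD)

lemma reach_arc: "{u, v} \<in> H \<Longrightarrow> (u, v) \<in> (adjacency H)\<^sup>*"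
  unfolding adjacency_def by blast

lemma component_eq_iff: "component H u = component H v \<longleftrightarrow> (u, v) \<in> (adjacency H)\<^sup>*"
  by (auto dest: reach_sym intro: rtrancl_trans)

lemma component_closed:
  assumes "v \<in> Z" "\<And>u w. u \<in> Z \<Longrightarrow> {u, w} \<in> H \<Longrightarrow> w \<in> Z"
  shows "component H v \<subseteq> Z"
proof
  fix w assume "w \<in> component H v"
  then have "(v, w) \<in> (adjacency H)\<^sup>*" by simp
  then show "w \<in> Z"
    by (induction rule: rtrancl_induct) (use assms in \<open>auto simp: adjacency_def\<close>)
qed

lemma reach_image:
  "(u, v) \<in> (adjacency H)\<^sup>* \<Longrightarrow> (f u, f v) \<in> (adjacency ((`) f ` H))\<^sup>*"
proof (induction rule: rtrancl_induct)
  case (step v w)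
  then have "{v, w} \<in> H" unfolding adjacency_def by simp
  from imageI[OF this, of "(`) f"] have "{f v, f w} \<in> (`) f ` H" by simp
  then show ?case using step by (meson reach_arc rtrancl_trans)
qed simp

lemma component_image_bij:
  assumes "bij f"
  shows "component ((`) f ` H) (f v) = f ` component H v"
proof
  show "f ` component H v \<subseteq> component ((`) f ` H) (f v)"
    using reach_image[of v _ H f] by auto
  have inv: "(`) (inv f) ` (`) f ` H = H"
    using assms by (simp add: image_image bij_is_inj image_inv_f_f)
  show "component ((`) f ` H) (f v) \<subseteq> f ` component H v"
  proof
    fix w assume "w \<in> component ((`) f ` H) (f v)"
    then have "(f v, w) \<in> (adjacency ((`) f ` H))\<^sup>*" by simp
    then have "(inv f (f v), inv f w) \<in> (adjacency ((`) (inv f) ` (`) f ` H))\<^sup>*"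
      by (rule reach_image)
    then have "(v, inv f w) \<in> (adjacency H)\<^sup>*"
      unfolding inv using assms by (simp add: bij_is_inj)
    moreover have "w = f (inv f w)" using assms by (simp add: bij_is_surj surj_f_inv_f)
    ultimately show "w \<in> f ` component H v" by blast
  qed
qed

text \<open>\<open>H1\<close> contains the path from \<open>x\<close> over \<open>p\<close> and
  \<open>r\<close> to \<open>y\<close>; in \<open>H2\<close> it is shortened to an arc from
  \<open>x\<close> to \<open>y\<close>, and \<open>{p, r}\<close> is left as a component of its own.
  In the applications these are the pictures before and after \<open>rewire\<close>, the cap
  \<open>{p, r}\<close> being supplied by the other diagram.\<close>

locale rewired =
  fixes H :: "'a set set" and p r x y :: 'a
  assumes avoid: "\<And>c. c \<in> H \<Longrightarrow> p \<notin> c \<and> r \<notin> c"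
    and outside: "x \<notin> {p, r}" "y \<notin> {p, r}"
begin

abbreviation "H1 \<equiv> insert {p, r} (insert {p, x} (insert {r, y} H))"
abbreviation "H2 \<equiv> insert {p, r} (insert {x, y} H)"

lemma reach_2_1:
  assumes "(u, v) \<in> (adjacency H2)\<^sup>*" "u \<notin> {p, r}"
  shows "v \<notin> {p, r} \<and> (u, v) \<in> (adjacency H1)\<^sup>*"
  using assms
proof (induction rule: rtrancl_induct)
  case (step v w)
  have v: "v \<notin> {p, r}" "(u, v) \<in> (adjacency H1)\<^sup>*" using step by auto
  have e: "{v, w} \<in> H2" using step(2) by (simp add: adjacency_def)
  then consider "{v, w} = {x, y}" | "{v, w} \<in> H" using v by (auto simp: doubleton_eq_iff)
  then show ?case
  proof cases
    case 1
    have xp: "(x, p) \<in> (adjacency H1)\<^sup>*" by (rule reach_arc) (simp add: insert_commute)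
    have pr: "(p, r) \<in> (adjacency H1)\<^sup>*" by (rule reach_arc) simp
    have ry: "(r, y) \<in> (adjacency H1)\<^sup>*" by (rule reach_arc) simp
    have "(x, y) \<in> (adjacency H1)\<^sup>*" using xp pr ry by (meson rtrancl_trans)
    then have "(v, w) \<in> (adjacency H1)\<^sup>*" using 1 reach_sym by (auto simp: doubleton_eq_iff)
    then show ?thesis using 1 outside v by (auto simp: doubleton_eq_iff)
  next
    case 2
    then have "(v, w) \<in> (adjacency H1)\<^sup>*" by (intro reach_arc) simp
    moreover have "w \<notin> {p, r}" using avoid[OF 2] by auto
    ultimately show ?thesis using v by (meson rtrancl_trans)
  qed
qed simp

text \<open>Walks are projected by the retraction sending \<open>p\<close> and \<open>r\<close> to
  \<open>x\<close>: it collapses \<open>{p, r}\<close> and \<open>{p, x}\<close> and carries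
  \<open>{r, y}\<close> to \<open>{x, y}\<close>.\<close>

lemma reach_1_2:
  assumes "(u, v) \<in> (adjacency H1)\<^sup>*" "u \<notin> {p, r}"
  shows "(u, if v \<in> {p, r} then x else v) \<in> (adjacency H2)\<^sup>*"
  using assms
proof (induction rule: rtrancl_induct)
  case (step v w)
  let ?g = "\<lambda>v. if v \<in> {p, r} then x else v"
  have e: "{v, w} \<in> H1" using step(2) by (simp add: adjacency_def)
  have xy: "(x, y) \<in> (adjacency H2)\<^sup>*" by (rule reach_arc) simp
  have "(?g v, ?g w) \<in> (adjacency H2)\<^sup>*"
  proof (cases "{v, w} \<in> H")
    case True
    then have "v \<notin> {p, r}" "w \<notin> {p, r}" using avoid by auto
    then show ?thesis using True by (auto intro: reach_arc)
  next
    case False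
    then have "{v, w} = {p, r} \<or> {v, w} = {p, x} \<or> {v, w} = {r, y}" using e by blast
    then show ?thesis using xy reach_sym[OF xy] outside by (auto simp: doubleton_eq_iff)
  qed
  then show ?case using step by (meson rtrancl_trans)
qed simp

lemma component_rewired:
  assumes "u \<notin> {p, r}" shows "component H2 u = component H1 u - {p, r}"
proof
  show "component H2 u \<subseteq> component H1 u - {p, r}" using reach_2_1[OF _ assms] by auto
  show "component H1 u - {p, r} \<subseteq> component H2 u"
  proof
    fix v assume "v \<in> component H1 u - {p, r}"
    then show "v \<in> component H2 u" using reach_1_2[OF _ assms, of v] by simp
  qed
qed

lemma component_rewired_cap:
  assumes "v \<in> {p, r}" shows "component H2 v = {p, r}"
proof
  show "component H2 v \<subseteq> {p, r}"
    by (rule component_closed) (use assms avoid outside in \<open>auto simp: doubleton_eq_iff\<close>)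
  show "{p, r} \<subseteq> component H2 v"
    using assms reach_arc[of p r H2] reach_sym[of p r H2] by auto
qed

lemma component_x: "v \<in> {p, r} \<Longrightarrow> component H1 v = component H1 x"
proof -
  have xp: "(x, p) \<in> (adjacency H1)\<^sup>*" by (rule reach_arc) (simp add: insert_commute)
  have pr: "(p, r) \<in> (adjacency H1)\<^sup>*" by (rule reach_arc) simp
  show "component H1 v = component H1 x" if "v \<in> {p, r}"
    using that reach_sym[OF xp] reach_sym[OF rtrancl_trans[OF xp pr]] unfolding component_eq_iff by blast
qed

text \<open>Removing \<open>p\<close> and \<open>r\<close> maps the old components injectively to
  the new ones and misses only \<open>{p, r}\<close>. With \<open>B = range Mid\<close> this counts
  closed loops, with \<open>B = UNIV\<close> all components. The last assumption ensures that a
  counted component through \<open>p\<close> or \<open>r\<close> still has a starting point in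
  \<open>V\<close> outside \<open>{p, r}\<close>, namely \<open>x\<close>.\<close>

lemma card_components_rewired:
  assumes V: "finite V" "p \<in> V" "p \<in> B" "r \<in> B" "x \<in> B \<Longrightarrow> x \<in> V"
  shows "card {C. (\<exists>v\<in>V. C = component H2 v) \<and> C \<subseteq> B}
    = card {C. (\<exists>v\<in>V. C = component H1 v) \<and> C \<subseteq> B} + 1"
    (is "card ?K2 = card ?K1 + 1")
proof -
  let ?g = "\<lambda>C. C - {p, r}"
  have rep: "\<exists>v\<in>V. v \<notin> {p, r} \<and> C = component H1 v" if C: "C \<in> ?K1" for C
  proof -
    obtain v where v: "v \<in> V" "C = component H1 v" "C \<subseteq> B" using C by blast
    show ?thesis
    proof (cases "v \<in> {p, r}")
      case True
      then have "C = component H1 x" using component_x v by blast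
      moreover from this have "x \<in> B" using v by auto
      ultimately show ?thesis using V outside by blast
    qed (use v in blast)
  qed
  have "?K2 = insert {p, r} (?g ` ?K1)"
  proof (rule Set.equalityI)
    show "?K2 \<subseteq> insert {p, r} (?g ` ?K1)"
    proof
      fix C assume "C \<in> ?K2"
      then obtain v where v: "v \<in> V" "C = component H2 v" "C \<subseteq> B" by blast
      show "C \<in> insert {p, r} (?g ` ?K1)"
      proof (cases "v \<in> {p, r}")
        case True
        then show ?thesis using component_rewired_cap v by blast
      next
        case False
        then have C: "C = ?g (component H1 v)" using component_rewired v by blast
        then have "component H1 v \<subseteq> B" using v V by blast
        then show ?thesis using C v by blast
      qed
    qed
    show "insert {p, r} (?g ` ?K1) \<subseteq> ?K2"
    proof
      fix C assume "C \<in> insert {p, r} (?g ` ?K1)"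
      then consider "C = {p, r}" | K where "K \<in> ?K1" "C = ?g K" by blast
      then show "C \<in> ?K2"
      proof cases
        case 1
        then show ?thesis using component_rewired_cap[of p] V by blast
      next
        case 2
        then obtain v where v: "v \<in> V" "v \<notin> {p, r}" "K = component H1 v" using rep by blast
        then have "C = component H2 v" using component_rewired 2 by blast
        then show ?thesis using v 2 by blast
      qed
    qed
  qed
  moreover have "{p, r} \<notin> ?g ` ?K1" by blast
  moreover have "inj_on ?g ?K1"
  proof (rule inj_onI)
    fix C K assume *: "C \<in> ?K1" "K \<in> ?K1" "?g C = ?g K"
    obtain v where v: "v \<notin> {p, r}" "C = component H1 v" using rep[OF *(1)] by blast
    obtain w where w: "K = component H1 w" using rep[OF *(2)] by blast
    have "v \<in> C" using v by blast
    then have "v \<in> K" using v(1) *(3) by blast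
    then show "C = K" using v w component_eq_iff by (metis Image_singleton_iff)
  qed
  moreover have "finite ?K1" by (rule finite_subset[of _ "component H1 ` V"]) (use V in auto)
  ultimately show ?thesis by (simp add: card_image)
qed

end

section \<open>Planar diagrams\<close>

text \<open>The definition orders all four end points; in this form the ends \<open>u\<close> and
  \<open>v\<close> need not be ordered: they lie on the same side of the other arc.\<close>

lemma noncrossingD:
  assumes "noncrossing M" "{u, v} \<in> M" "{b, d} \<in> M" "u \<notin> {b, d}" "v \<notin> {b, d}"
  shows "b < u \<and> u < d \<longleftrightarrow> b < v \<and> v < d"
proof (rule ccontr)
  assume *: "\<not> ?thesis"
  have nc: "\<not> (p < q \<and> q < r \<and> r < s \<and> {p, r} \<in> M \<and> {q, s} \<in> M)" for p q r s
    using assms(1) unfolding noncrossing_def by blast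
  have "{v, u} \<in> M" "{d, b} \<in> M" using assms by (auto simp: insert_commute)
  then show False
    using * assms(2-5) nc[of b u d v] nc[of b v d u] nc[of u b v d] nc[of v b u d]
    by simp linarith
qed

text \<open>No other arc separates \<open>p\<close> from its neighbour \<open>Suc p\<close>, so
  their partners \<open>x\<close> and \<open>y\<close> lie on the same side of each remaining arc,
  and joining them creates no crossing.\<close>

lemma noncrossing_rewire:
  assumes pm: "perfect_matching A M" and nc: "noncrossing M" and A: "p \<in> A" "Suc p \<in> A"
  shows "noncrossing (rewire p (Suc p) M)"
proof (cases "{p, Suc p} \<in> M")
  case True
  then show ?thesis using rewire_arc assms by metis
next
  case False
  obtain x y M0 where *: "x \<notin> {p, Suc p}" "y \<notin> {p, Suc p}"
    "M = insert {p, x} (insert {Suc p, y} M0)" "\<forall>c\<in>M0. c \<inter> {p, Suc p, x, y} = {}"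
    "rewire p (Suc p) M = insert {p, Suc p} (insert {x, y} M0)"
    using perfect_matching_two_arcs[OF pm A n_not_Suc_n False] by metis
  have arcs: "{p, x} \<in> M" "{Suc p, y} \<in> M" using * by auto
  have same: "b < x \<and> x < d \<longleftrightarrow> b < y \<and> y < d" if "{b, d} \<in> M0" for b d
  proof -
    have "{b, d} \<in> M" "{b, d} \<inter> {p, Suc p, x, y} = {}" using * that by auto
    then have bd: "{b, d} \<in> M" "p \<notin> {b, d}" "Suc p \<notin> {b, d}" "x \<notin> {b, d}" "y \<notin> {b, d}" by blast+
    have "b < p \<and> p < d \<longleftrightarrow> b < x \<and> x < d" by (rule noncrossingD[OF nc arcs(1) bd(1,2,4)])
    moreover have "b < Suc p \<and> Suc p < d \<longleftrightarrow> b < y \<and> y < d"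
      by (rule noncrossingD[OF nc arcs(2) bd(1,3,5)])
    moreover have "b < p \<and> p < d \<longleftrightarrow> b < Suc p \<and> Suc p < d" using bd(2,3) by auto
    ultimately show ?thesis by blast
  qed
  show ?thesis unfolding noncrossing_def
  proof (intro notI, elim exE conjE)
    fix a b c d assume o: "a < b" "b < c" "c < d"
      and ac: "{a, c} \<in> rewire p (Suc p) M" and bd: "{b, d} \<in> rewire p (Suc p) M"
    have "{a, c} \<noteq> {p, Suc p}" "{b, d} \<noteq> {p, Suc p}" "{a, c} \<noteq> {b, d}"
      using o by (auto simp: doubleton_eq_iff)
    then consider "{a, c} = {x, y}" "{b, d} \<in> M0" | "{b, d} = {x, y}" "{a, c} \<in> M0"
      | "{a, c} \<in> M0" "{b, d} \<in> M0"
      using ac bd unfolding *(5) insert_iff by argo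
    then show False
    proof cases
      case 1
      then show ?thesis using same[of b d] o by (auto simp: doubleton_eq_iff)
    next
      case 2
      then show ?thesis using same[of a c] o by (auto simp: doubleton_eq_iff)
    next
      case 3
      then have "{a, c} \<in> M" "{b, d} \<in> M" using * by auto
      then show ?thesis using nc o unfolding noncrossing_def by blast
    qed
  qed
qed

section \<open>The bijection between diagrams and capforms\<close>

lemma inj_on_fold_pt: "inj_on (fold_pt n) (points n)"
  unfolding points_def by (intro inj_onI) auto

lemma fold_pt_image: "fold_pt n ` points n = {1..2 * n}"
proof
  show "{1..2 * n} \<subseteq> fold_pt n ` points n"
  proof
    fix j assume j: "j \<in> {1..2 * n}"
    show "j \<in> fold_pt n ` points n"
    proof (cases "j \<le> n")
      case True
      then have "Lower j \<in> points n" "j = fold_pt n (Lower j)" using j by (auto simp: points_def)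
      then show ?thesis by blast
    next
      case False
      then have "2 * n + 1 - j \<in> {1..n}" using j by auto
      then have "Upper (2 * n + 1 - j) \<in> points n" "j = fold_pt n (Upper (2 * n + 1 - j))"
        using j unfolding points_def by (blast, simp)
      then show ?thesis by blast
    qed
  qed
qed (auto simp: points_def)

lemma finite_points: "finite (points n)"
  by (simp add: points_def)

lemma tl_diagramsD:
  assumes "D \<in> tl_diagrams n"
  shows "perfect_matching (points n) D" "noncrossing (capform n D)"
    "perfect_matching {1..2 * n} (capform n D)"
  using assms perfect_matching_image[OF _ inj_on_fold_pt]
  unfolding tl_diagrams_def capform_def fold_pt_image by blast+

lemma finite_tl_diagrams: "finite (tl_diagrams n)"
proof (rule finite_subset)
  show "tl_diagrams n \<subseteq> Pow (Pow (points n))" using tl_diagramsD(1) perfect_matching_subset by blast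
qed (simp add: finite_points)

lemma inj_on_capform: "inj_on (capform n) (tl_diagrams n)"
proof (rule inj_onI)
  fix D E assume *: "D \<in> tl_diagrams n" "E \<in> tl_diagrams n" "capform n D = capform n E"
  have "D \<in> Pow (Pow (points n))" "E \<in> Pow (Pow (points n))"
    using tl_diagramsD(1) perfect_matching_subset * by blast+
  then show "D = E"
    by (rule inj_onD[OF inj_on_image_Pow[OF inj_on_image_Pow[OF inj_on_fold_pt]] *(3)[unfolded capform_def]])
qed

lemma capform_surj:
  assumes "perfect_matching {1..2 * n} M" "noncrossing M"
  obtains D where "D \<in> tl_diagrams n" "capform n D = M"
proof -
  define g where "g = inv_into (points n) (fold_pt n)"
  have inj: "inj_on g {1..2 * n}" unfolding g_def fold_pt_image[symmetric] by (rule inj_on_inv_into) simp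
  have img: "g ` {1..2 * n} = points n"
    unfolding g_def fold_pt_image[symmetric] using inj_on_fold_pt by (simp add: inv_into_f_f image_image)
  have "fold_pt n ` g ` c = c" if "c \<in> M" for c
  proof -
    have "c \<subseteq> fold_pt n ` points n" using perfect_matching_subset[OF assms(1) that] fold_pt_image by simp
    then show ?thesis unfolding g_def by (rule image_inv_into_cancel[OF refl])
  qed
  then have "capform n ((`) g ` M) = M" unfolding capform_def image_image by simp
  moreover from this have "(`) g ` M \<in> tl_diagrams n"
    using perfect_matching_image[OF assms(1) inj] assms(2) unfolding img tl_diagrams_def by simp
  ultimately show ?thesis using that by blast
qed

lemma capform_rewire:
  assumes "D \<in> tl_diagrams n" "1 \<le> i" "i < n"
  shows "capform n (rewire (Lower i) (Lower (i + 1)) D) = rewire i (i + 1) (capform n D)"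
  unfolding capform_def
  using rewire_image[OF tl_diagramsD(1)[OF assms(1)] _ _ _ inj_on_fold_pt, of "Lower i" "Lower (i + 1)"]
    assms by (auto simp: points_def)

lemma rewire_tl_diagrams:
  assumes "D \<in> tl_diagrams n" "1 \<le> i" "i < n"
  shows "rewire (Lower i) (Lower (i + 1)) D \<in> tl_diagrams n"
proof -
  have "perfect_matching (points n) (rewire (Lower i) (Lower (i + 1)) D)"
    by (rule perfect_matching_rewire[OF tl_diagramsD(1)[OF assms(1)]])
      (use assms in \<open>auto simp: points_def\<close>)
  moreover have "noncrossing (rewire i (i + 1) (capform n D))"
    using noncrossing_rewire[OF tl_diagramsD(3,2)[OF assms(1)], of i] assms by simp
  ultimately show ?thesis using capform_rewire[OF assms] unfolding tl_diagrams_def by simp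
qed

section \<open>Caps in non-identity diagrams\<close>

definition id_diagram :: "nat \<Rightarrow> diagram" where
  "id_diagram n = {{Upper j, Lower j} | j. j \<in> {1..n}}"

lemma capform_id_diagram: "capform n (id_diagram n) = {{2 * n + 1 - j, j} | j. j \<in> {1..n}}"
proof -
  have "id_diagram n = (\<lambda>j. {Upper j, Lower j}) ` {1..n}"
    "{{2 * n + 1 - j, j} | j. j \<in> {1..n}} = (\<lambda>j. {2 * n + 1 - j, j}) ` {1..n}"
    unfolding id_diagram_def by blast+
  then show ?thesis unfolding capform_def by (simp add: image_image)
qed

lemma id_diagram_tl: "id_diagram n \<in> tl_diagrams n"
proof -
  have "perfect_matching (points n) (id_diagram n)"
  proof (rule perfect_matchingI)
    show "\<exists>c\<in>id_diagram n. x \<in> c" if x: "x \<in> points n" for x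
    proof -
      obtain j where j: "j \<in> {1..n}" "x \<in> {Upper j, Lower j}" using x unfolding points_def by blast
      then have "{Upper j, Lower j} \<in> id_diagram n" unfolding id_diagram_def by blast
      then show ?thesis using j by blast
    qed
  qed (auto simp: id_diagram_def points_def)
  moreover have "noncrossing (capform n (id_diagram n))"
    unfolding noncrossing_def capform_id_diagram by (auto simp: doubleton_eq_iff)
  ultimately show ?thesis unfolding tl_diagrams_def by simp
qed

text \<open>Without a cap in the left half no arc stays inside it, since an innermost such arc would
  be a cap. So left points are matched with right points, and the only non-crossing way to do this
  is complete nesting.\<close>

lemma nested_if_no_cap:
  assumes pm: "perfect_matching {1..2 * n} M" and nc: "noncrossing M"
    and cap: "\<And>i. 1 \<le> i \<Longrightarrow> i < n \<Longrightarrow> {i, i + 1} \<notin> M" and j: "j \<in> {1..n}"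
  shows "{j, 2 * n + 1 - j} \<in> M"
proof -
  have no_arc: "{a, b} \<notin> M" if "1 \<le> a" "a < b" "b \<le> n" for a b
    using that
  proof (induction "b - a" arbitrary: a b rule: less_induct)
    case less
    show ?case
    proof
      assume ab: "{a, b} \<in> M"
      show False
      proof (cases "b = a + 1")
        case True
        then show False using cap[of a] ab less by simp
      next
        case False
        \<comment> \<open>The partner of \<open>a + 1\<close> is trapped under the arc, which yields
          a shorter arc in the left half.\<close>
        obtain z where z: "{a + 1, z} \<in> M" "z \<noteq> a + 1"
          using perfect_matching_mate[OF pm, of "a + 1"] less.prems
          by (metis One_nat_def Suc_eq_plus1 atLeastAtMost_iff le_add2 less_eq_Suc_le mult_2 order_trans trans_le_add1)
        have "z \<notin> {a, b}"
          using perfect_matching_unique[OF pm ab z(1), of z] z(2) less False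
          by (auto simp: doubleton_eq_iff)
        then have "a < z" "z < b" using noncrossingD[OF nc z(1) ab] less False by auto
        then show False using less(1)[of z "a + 1"] z less by auto
      qed
    qed
  qed
  have "\<exists>m. {j, m} \<in> M \<and> n < m \<and> m \<le> 2 * n" if j: "j \<in> {1..n}" for j
  proof -
    obtain m where m: "{j, m} \<in> M" "m \<noteq> j" "m \<in> {1..2 * n}"
      using perfect_matching_mate[OF pm, of j] j by auto
    then have "{m, j} \<in> M" by (simp add: insert_commute)
    then have "\<not> m \<le> n" using no_arc[of j m] no_arc[of m j] m j by (cases "j < m") auto
    then have "n < m" by simp
    then show ?thesis using m by auto
  qed
  then obtain m where m: "\<And>j. j \<in> {1..n} \<Longrightarrow> {j, m j} \<in> M \<and> n < m j \<and> m j \<le> 2 * n" by metis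
  have dec: "m (Suc j) < m j" if "1 \<le> j" "j < n" for j
  proof (rule ccontr)
    assume "\<not> m (Suc j) < m j"
    moreover have arcs: "{j, m j} \<in> M" "{Suc j, m (Suc j)} \<in> M" "n < m j" "n < m (Suc j)"
      using m[of j] m[of "Suc j"] that by auto
    moreover have "m j \<noteq> m (Suc j)"
      using perfect_matching_unique[OF pm arcs(1,2), of "m j"] that arcs(4) by (auto simp: doubleton_eq_iff)
    ultimately have "j < Suc j" "Suc j < m j" "m j < m (Suc j)" using that by auto
    then show False using nc arcs unfolding noncrossing_def by blast
  qed
  \<comment> \<open>A strictly decreasing map from \<open>{1..n}\<close> to
    \<open>{n + 1..2 * n}\<close> has no slack: the bounds obtained from its two ends
    coincide.\<close>
  have up: "j \<in> {1..n} \<longrightarrow> m j \<le> 2 * n + 1 - j" for j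
  proof (induction j)
    case (Suc j)
    show ?case
    proof (cases "j = 0")
      case True
      then show ?thesis using m[of 1] by auto
    next
      case False
      then show ?thesis using Suc dec[of j] by auto
    qed
  qed simp
  have lo: "d < n \<longrightarrow> n + 1 + d \<le> m (n - d)" for d
  proof (induction d)
    case 0
    then show ?case using m[of n] by auto
  next
    case (Suc d)
    show ?case
    proof
      assume d: "Suc d < n"
      then have "m (n - d) < m (n - Suc d)" using dec[of "n - Suc d"] by (simp add: Suc_diff_Suc)
      then show "n + 1 + Suc d \<le> m (n - Suc d)" using Suc d by simp
    qed
  qed
  have "m j = 2 * n + 1 - j" using up[of j] lo[of "n - j"] j by auto
  then show ?thesis using m[OF j] by simp
qed

lemma lower_cap_exists:
  assumes "D \<in> tl_diagrams n" "D \<noteq> id_diagram n"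
  obtains i where "1 \<le> i" "i < n" "{Lower i, Lower (i + 1)} \<in> D"
proof -
  have "\<exists>i. 1 \<le> i \<and> i < n \<and> {i, i + 1} \<in> capform n D"
  proof (rule ccontr)
    assume "\<not> ?thesis"
    then have "{j, 2 * n + 1 - j} \<in> capform n D" if "j \<in> {1..n}" for j
      using nested_if_no_cap[OF tl_diagramsD(3,2)[OF assms(1)]] that by blast
    then have "capform n (id_diagram n) \<subseteq> capform n D"
      unfolding capform_id_diagram by (auto simp: insert_commute)
    then have "capform n (id_diagram n) = capform n D"
      using perfect_matching_subset_eq tl_diagramsD(3) id_diagram_tl assms(1) by metis
    then show False using inj_onD[OF inj_on_capform] assms id_diagram_tl by metis
  qed
  then obtain i where i: "1 \<le> i" "i < n" "{i, i + 1} \<in> capform n D" by blast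
  then obtain c where c: "c \<in> D" "fold_pt n ` c = {i, i + 1}" unfolding capform_def by auto
  have "c \<subseteq> points n" using perfect_matching_subset[OF tl_diagramsD(1)] c assms by blast
  moreover have "fold_pt n ` {Lower i, Lower (i + 1)} = fold_pt n ` c" using c by simp
  moreover have "{Lower i, Lower (i + 1)} \<subseteq> points n" using i by (auto simp: points_def)
  ultimately have "{Lower i, Lower (i + 1)} = c" using inj_on_image_eq_iff[OF inj_on_fold_pt] by metis
  then show ?thesis using that i c by blast
qed

section \<open>Reflection in a horizontal axis\<close>

fun flip_pt :: "pt \<Rightarrow> pt" where
  "flip_pt (Upper j) = Lower j"
| "flip_pt (Lower j) = Upper j"

definition flip :: "diagram \<Rightarrow> diagram" where
  "flip D = (`) flip_pt ` D"

lemma flip_pt_flip_pt [simp]: "flip_pt (flip_pt x) = x"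
  by (cases x) auto

lemma flip_flip [simp]: "flip (flip D) = D"
  unfolding flip_def by (simp add: image_image)

lemma bij_flip_pt: "bij flip_pt"
  by (rule o_bij[of flip_pt]) auto

lemma flip_tl: 
  assumes "D \<in> tl_diagrams n" shows "flip D \<in> tl_diagrams n"
proof -
  have pts: "flip_pt ` points n = points n" by (auto simp: points_def image_Un image_image)
  have pm: "perfect_matching (points n) (flip D)"
    using perfect_matching_image[OF tl_diagramsD(1)[OF assms] inj_on_subset[OF bij_is_inj[OF bij_flip_pt]]] pts
    unfolding flip_def by simp
  have fold: "fold_pt n (flip_pt x) = 2 * n + 1 - fold_pt n x" if "x \<in> points n" for x
    using that by (auto simp: points_def)
  \<comment> \<open>On folded points the reflection is \<open>j\<close> to
    \<open>2 * n + 1 - j\<close>, which reverses the order and so keeps arcs non-crossing. The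
    bounds are recorded because truncated subtraction reverses strict inequalities only up to
    \<open>2 * n + 1\<close>.\<close>
  have arc: "{2 * n + 1 - a, 2 * n + 1 - b} \<in> capform n D \<and> a \<le> 2 * n \<and> b \<le> 2 * n"
    if ab: "{a, b} \<in> capform n (flip D)" for a b
  proof -
    obtain c where c: "c \<in> D" "{a, b} = fold_pt n ` flip_pt ` c"
      using ab unfolding capform_def flip_def by blast
    have sub: "c \<subseteq> points n" using perfect_matching_subset[OF tl_diagramsD(1)[OF assms] c(1)] .
    have "(\<lambda>j. 2 * n + 1 - j) ` {a, b} = (\<lambda>x. 2 * n + 1 - (2 * n + 1 - fold_pt n x)) ` c"
      unfolding c(2) image_image by (rule image_cong) (use fold sub in auto)
    also have "\<dots> = fold_pt n ` c"
    proof (rule image_cong)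
      fix x assume "x \<in> c"
      then have "fold_pt n x \<in> {1..2 * n}" using fold_pt_image[of n] sub by blast
      then show "2 * n + 1 - (2 * n + 1 - fold_pt n x) = fold_pt n x" by auto
    qed simp
    finally have "{2 * n + 1 - a, 2 * n + 1 - b} = fold_pt n ` c" by simp
    then have "{2 * n + 1 - a, 2 * n + 1 - b} \<in> capform n D" using c(1) unfolding capform_def by blast
    moreover have "{a, b} \<subseteq> {1..2 * n}"
      using c(2) sub pts fold_pt_image[of n] by (metis image_mono)
    ultimately show ?thesis by simp
  qed
  have "noncrossing (capform n (flip D))"
    unfolding noncrossing_def
  proof (intro notI, elim exE conjE)
    fix a b c d assume o: "a < b" "b < c" "c < d"
      and "{a, c} \<in> capform n (flip D)" "{b, d} \<in> capform n (flip D)"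
    then have "{2 * n + 1 - c, 2 * n + 1 - a} \<in> capform n D" "{2 * n + 1 - d, 2 * n + 1 - b} \<in> capform n D"
      "d \<le> 2 * n" using arc by (auto simp: insert_commute)
    moreover from this have "2 * n + 1 - d < 2 * n + 1 - c" "2 * n + 1 - c < 2 * n + 1 - b"
      "2 * n + 1 - b < 2 * n + 1 - a" using o by auto
    ultimately show False using tl_diagramsD(2)[OF assms] unfolding noncrossing_def by blast
  qed
  then show ?thesis using pm unfolding tl_diagrams_def by simp
qed

lemma flip_id_diagram [simp]: "flip (id_diagram n) = id_diagram n"
proof -
  have "id_diagram n = (\<lambda>j. {Upper j, Lower j}) ` {1..n}" unfolding id_diagram_def by blast
  then show ?thesis unfolding flip_def by (simp add: image_image insert_commute)
qed

lemma upper_cap_exists: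
  assumes "D \<in> tl_diagrams n" "D \<noteq> id_diagram n"
  obtains i where "1 \<le> i" "i < n" "{Upper i, Upper (i + 1)} \<in> D"
proof -
  have "flip D \<noteq> id_diagram n" using assms(2) by (metis flip_flip flip_id_diagram)
  then obtain i where i: "1 \<le> i" "i < n" "{Lower i, Lower (i + 1)} \<in> flip D"
    using lower_cap_exists[OF flip_tl[OF assms(1)]] by metis
  from imageI[OF i(3), of "(`) flip_pt"] have "{Upper i, Upper (i + 1)} \<in> flip (flip D)"
    unfolding flip_def[of "flip D"] by simp
  then show ?thesis using that i by simp
qed

section \<open>Stacking\<close>

lemma stack_arcs_eq:
  "stack_arcs D E = adjacency ((`) upper_half ` D \<union> (`) lower_half ` E)"
  unfolding stack_arcs_def adjacency_def ..

lemma inj_upper_half: "inj upper_half"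
  by (rule injI) (metis upper_half.elims stack_pt.inject(1,2) stack_pt.distinct(1))

lemma inj_lower_half: "inj lower_half"
  by (rule injI) (metis lower_half.elims stack_pt.inject(2,3) stack_pt.distinct(5))

lemma outer_neq_Mid [simp]: "outer x \<noteq> Mid j" "Mid j \<noteq> outer x"
  by (cases x; simp)+

lemma outer_eq_iff [simp]:
  "outer x = Top j \<longleftrightarrow> x = Upper j" "outer x = Bot j \<longleftrightarrow> x = Lower j"
  "Top j = outer x \<longleftrightarrow> x = Upper j" "Bot j = outer x \<longleftrightarrow> x = Lower j"
  by (cases x; auto)+

lemma inj_outer: "inj outer"
proof (rule injI)
  fix x y assume "outer x = outer y"
  then show "x = y" by (cases y) auto
qed

text \<open>Placing \<open>e_i\<close> between \<open>D\<close> and a diagram with an upper cap at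
  \<open>i\<close> only adds a closed loop: that cap already joins the middle points
  \<open>i\<close> and \<open>i + 1\<close>, so shortening the path through them changes no
  connection between outer points. The indicator covers the case in which the loop is already
  present and rewiring does nothing.\<close>

lemma stack_rewire:
  assumes D: "perfect_matching (points n) D" and E: "perfect_matching (points n) E"
    and i: "1 \<le> i" "i < n" and cap: "{Upper i, Upper (i + 1)} \<in> E"
  shows "stack (rewire (Lower i) (Lower (i + 1)) D) E = stack D E"
    and "loops n D E + 1 = loops n (rewire (Lower i) (Lower (i + 1)) D) E
      + (if {Lower i, Lower (i + 1)} \<in> D then 1 else 0)"
proof -
  have "stack (rewire (Lower i) (Lower (i + 1)) D) E = stack D E \<and>
    loops n D E + 1 = loops n (rewire (Lower i) (Lower (i + 1)) D) E
      + (if {Lower i, Lower (i + 1)} \<in> D then 1 else 0)"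
  proof (cases "{Lower i, Lower (i + 1)} \<in> D")
    case True
    then show ?thesis using rewire_arc[OF D True] by simp
  next
    case False
    let ?D = "rewire (Lower i) (Lower (i + 1)) D"
    have pts: "Lower i \<in> points n" "Lower (i + 1) \<in> points n" "Lower i \<noteq> Lower (i + 1)"
      using i by (auto simp: points_def)
    obtain x y M where xy: "x \<notin> {Lower i, Lower (i + 1)}" "y \<notin> {Lower i, Lower (i + 1)}"
      "x \<in> points n"
      and DM: "D = insert {Lower i, x} (insert {Lower (i + 1), y} M)"
      and M: "\<forall>c\<in>M. c \<inter> {Lower i, Lower (i + 1), x, y} = {}"
      and D': "?D = insert {Lower i, Lower (i + 1)} (insert {x, y} M)"
      using perfect_matching_two_arcs[OF D pts False] by metis
    define p r where "p = Mid i" and "r = Mid (i + 1)"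
    define H where "H = (`) upper_half ` M \<union> ((`) lower_half ` E - {{p, r}})"
    have pr_low: "{p, r} = lower_half ` {Upper i, Upper (i + 1)}" unfolding p_def r_def by simp
    have pr: "{p, r} \<in> (`) lower_half ` E" unfolding pr_low by (rule imageI[OF cap])
    interpret rewired H p r "upper_half x" "upper_half y"
    proof
      fix c assume "c \<in> H"
      then consider m where "m \<in> M" "c = upper_half ` m"
        | e where "e \<in> E" "c = lower_half ` e" "c \<noteq> {p, r}" unfolding H_def by blast
      then show "p \<notin> c \<and> r \<notin> c"
      proof cases
        case 1
        have "Lower i \<notin> m" "Lower (i + 1) \<notin> m" using M 1 by blast+
        moreover have "p = upper_half (Lower i)" "r = upper_half (Lower (i + 1))"
          unfolding p_def r_def by simp_all
        ultimately show ?thesis unfolding 1(2) by (metis inj_image_mem_iff[OF inj_upper_half])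
      next
        case 2
        have "Upper i \<notin> e" "Upper (i + 1) \<notin> e"
          using perfect_matching_unique[OF E 2(1) cap] 2 unfolding pr_low by blast+
        moreover have "p = lower_half (Upper i)" "r = lower_half (Upper (i + 1))"
          unfolding p_def r_def by simp_all
        ultimately show ?thesis unfolding 2(2) by (metis inj_image_mem_iff[OF inj_lower_half])
      qed
    next
      have "upper_half z \<notin> {p, r}" if "z \<notin> {Lower i, Lower (i + 1)}" for z
        using that unfolding p_def r_def by (cases z) auto
      then show "upper_half x \<notin> {p, r}" "upper_half y \<notin> {p, r}" using xy by auto
    qed
    have arcs1: "stack_arcs D E = adjacency H1"
    proof -
      have "(`) upper_half ` D \<union> (`) lower_half ` E = H1"
        using pr unfolding DM H_def p_def r_def by auto
      then show ?thesis unfolding stack_arcs_eq by simp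
    qed
    have arcs2: "stack_arcs ?D E = adjacency H2"
    proof -
      have "(`) upper_half ` ?D \<union> (`) lower_half ` E = H2"
        using pr unfolding D' H_def p_def r_def by auto
      then show ?thesis unfolding stack_arcs_eq by simp
    qed
    have "(outer u, outer v) \<in> (adjacency H2)\<^sup>* \<longleftrightarrow> (outer u, outer v) \<in> (adjacency H1)\<^sup>*" for u v
    proof -
      have "outer u \<notin> {p, r}" "outer v \<notin> {p, r}" unfolding p_def r_def by simp_all
      then show ?thesis using component_rewired[of "outer u"] by blast
    qed
    then have "stack ?D E = stack D E" unfolding stack_def arcs1 arcs2 by simp
    moreover have "card {C. (\<exists>v\<in>Mid ` {1..n}. C = component H2 v) \<and> C \<subseteq> range Mid}
      = card {C. (\<exists>v\<in>Mid ` {1..n}. C = component H1 v) \<and> C \<subseteq> range Mid} + 1"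
    proof (rule card_components_rewired)
      assume "upper_half x \<in> range Mid"
      then show "upper_half x \<in> Mid ` {1..n}" using xy(3) by (cases x) (auto simp: points_def)
    qed (use i in \<open>auto simp: p_def r_def\<close>)
    then have "loops n ?D E = loops n D E + 1" unfolding loops_def arcs1 arcs2 by simp
    ultimately show ?thesis using False by simp
  qed
  then show "stack (rewire (Lower i) (Lower (i + 1)) D) E = stack D E"
    "loops n D E + 1 = loops n (rewire (Lower i) (Lower (i + 1)) D) E
      + (if {Lower i, Lower (i + 1)} \<in> D then 1 else 0)" by auto
qed

text \<open>Serves for the identity, and for \<open>e_i\<close> below a diagram that already has the
  lower cap: an arc of \<open>E\<close> either continues a strand vertically, or closes a lower arc
  of \<open>D\<close> to a loop, or replaces such an arc on the lower edge.\<close>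

lemma stack_absorb:
  assumes D: "perfect_matching (points n) D" and E: "perfect_matching (points n) E"
    and arcs: "\<And>c. c \<in> E \<Longrightarrow> (\<exists>j. c = {Upper j, Lower j}) \<or>
      (\<exists>a b. {Lower a, Lower b} \<in> D \<and> (c = {Upper a, Upper b} \<or> c = {Lower a, Lower b}))"
  shows "stack D E = D"
proof -
  define H where "H = (`) upper_half ` D \<union> (`) lower_half ` E"
  have Earc: "x \<in> points n \<Longrightarrow> x = Upper j \<or> x = Lower j \<Longrightarrow> {Upper j, Lower j} \<in> E \<or>
      (\<exists>a. {Lower a, Lower j} \<in> D \<and> (x = Upper j \<and> {Upper a, Upper j} \<in> E \<or> x = Lower j \<and> {Lower a, Lower j} \<in> E))"
    for x j
  proof -
    assume x: "x \<in> points n" "x = Upper j \<or> x = Lower j"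
    obtain y where y: "{x, y} \<in> E" using perfect_matching_mate[OF E x(1)] by metis
    then show ?thesis using arcs[OF y] x(2) by (auto simp: doubleton_eq_iff insert_commute)
  qed
  have low: "(upper_half x, outer x) \<in> (adjacency H)\<^sup>*"
    if "x \<in> points n" "\<nexists>a b. x = Lower b \<and> {Lower a, Lower b} \<in> D \<and> {Lower a, Lower b} \<in> E" for x
  proof (cases x)
    case (Lower j)
    then have "{Upper j, Lower j} \<in> E" using Earc[OF that(1)] that(2) by blast
    from imageI[OF this, of "(`) lower_half"] have "{Mid j, Bot j} \<in> H" unfolding H_def by simp
    then show ?thesis using Lower reach_arc by simp
  qed simp
  have "{x, y} \<in> D" if xy: "(outer x, outer y) \<in> (adjacency H)\<^sup>*" "x \<noteq> y" for x y
  proof (cases "x \<in> points n")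
    case True
    obtain z where z: "{x, z} \<in> D" using perfect_matching_mate[OF D True] by metis
    define c where "c = {x, z}"
    have c: "c \<in> D" "x \<in> c" using z unfolding c_def by auto
    \<comment> \<open>The expected component: the ends of \<open>c\<close>, with the middle points
      from which it runs down a vertical strand. Middle points at a cap of \<open>E\<close> are left
      out, since they lie on closed loops.\<close>
    define Z where "Z = outer ` c \<union> {Mid j | j. Lower j \<in> c \<and> {Upper j, Lower j} \<in> E}"
    have csub: "c \<subseteq> points n" using perfect_matching_subset[OF D c(1)] .
    have "component H (outer x) \<subseteq> Z"
    proof (rule component_closed)
      show "outer x \<in> Z" using c unfolding Z_def by blast
      fix u w assume u: "u \<in> Z" and uw: "{u, w} \<in> H"
      consider d where "d \<in> D" "{u, w} = upper_half ` d" | e where "e \<in> E" "{u, w} = lower_half ` e"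
        using uw unfolding H_def by blast
      then show "w \<in> Z"
      proof cases
        case 1
        then obtain s t where st: "s \<in> d" "upper_half s = u" "t \<in> d" "upper_half t = w"
          by (metis imageE insertCI)
        have "s \<in> c" using u st(2) unfolding Z_def by (cases s) auto
        then have dc: "d = c" using perfect_matching_unique[OF D 1(1) c(1) st(1)] by simp
        show ?thesis
        proof (cases t)
          case (Upper k)
          then have "w = outer t" using st by simp
          then show ?thesis using st dc unfolding Z_def by blast
        next
          case (Lower k)
          have up: "Upper k \<in> points n" using csub st(3) dc Lower by (auto simp: points_def)
          have "{Upper k, Lower k} \<in> E"
          proof (rule ccontr)
            assume no: "{Upper k, Lower k} \<notin> E"
            then obtain a where a: "{Lower a, Lower k} \<in> D" "{Upper a, Upper k} \<in> E"
              using Earc[OF up, of k] by auto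
            have "c = {Lower a, Lower k}"
              using perfect_matching_unique[OF D c(1) a(1), of t] st(3) dc Lower by simp
            then have "s = Lower a \<or> s = Lower k" using \<open>s \<in> c\<close> by blast
            then have "u = Mid a \<or> u = Mid k" using st(2) by auto
            then have "{Upper a, Lower a} \<in> E \<or> {Upper k, Lower k} \<in> E" using u unfolding Z_def by auto
            then have "{Upper a, Lower a} \<in> E" using no by simp
            then have "{Upper a, Lower a} = {Upper a, Upper k}"
              using perfect_matching_unique[OF E _ a(2), of _ "Upper a"] by simp
            then show False by (auto simp: doubleton_eq_iff)
          qed
          then show ?thesis using st dc Lower unfolding Z_def by auto
        qed
      next
        case 2
        then obtain s t where st: "s \<in> e" "lower_half s = u" "t \<in> e" "lower_half t = w"
          by (metis imageE insertCI)
        show ?thesis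
        proof (cases "\<exists>j. e = {Upper j, Lower j}")
          case True
          then obtain j where j: "e = {Upper j, Lower j}" by blast
          have "u = Mid j \<or> u = Bot j" "w = Mid j \<or> w = Bot j" using st j by auto
          moreover from this have "Lower j \<in> c" using u unfolding Z_def by auto
          moreover from this have "Bot j \<in> outer ` c" by (metis imageI outer.simps(2))
          ultimately show ?thesis using 2(1) j unfolding Z_def by auto
        next
          case False
          then obtain a b where ab: "{Lower a, Lower b} \<in> D" "e = {Upper a, Upper b} \<or> e = {Lower a, Lower b}"
            using arcs[OF 2(1)] by auto
          show ?thesis
          proof (cases "e = {Upper a, Upper b}")
            case True
            then obtain j where j: "u = Mid j" "Upper j \<in> e" using st by auto
            then have "{Upper j, Lower j} \<in> E" using u unfolding Z_def by auto
            then show ?thesis using perfect_matching_unique[OF E _ 2(1), of _ "Upper j"] j False by blast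
          next
            case False
            then have e: "e = {Lower a, Lower b}" using ab by simp
            then obtain j where j: "u = Bot j" "Lower j \<in> e" using st by auto
            then have "Lower j \<in> c" using u unfolding Z_def by auto
            then have "c = e" using perfect_matching_unique[OF D c(1) ab(1), of "Lower j"] j e by simp
            moreover have "w = outer t" using st(3,4) e by auto
            ultimately show ?thesis using st(3) unfolding Z_def by blast
          qed
        qed
      qed
    qed
    then have "outer y \<in> outer ` c" using xy(1) unfolding Z_def by auto
    then have "y \<in> c" using inj_image_mem_iff[OF inj_outer] by metis
    then show ?thesis using xy(2) z unfolding c_def by auto
  next
    case False
    have "component H (outer x) \<subseteq> {outer x}"
    proof (rule component_closed)
      fix u w assume u: "u \<in> {outer x}" and "{u, w} \<in> H"
      then have "outer x \<in> upper_half ` points n \<union> lower_half ` points n"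
        using perfect_matching_subset[OF D] perfect_matching_subset[OF E] unfolding H_def by blast
      then have "x \<in> points n" by (cases x) (auto simp: points_def)
      then show "w \<in> {outer x}" using False by simp
    qed simp
    then have "outer y = outer x" using xy(1) by auto
    then show ?thesis using xy(2) injD[OF inj_outer] by metis
  qed
  moreover have "(outer x, outer y) \<in> (adjacency H)\<^sup>*" if xy: "{x, y} \<in> D" for x y
  proof (cases "\<exists>a b. x = Lower a \<and> y = Lower b \<and> {Lower a, Lower b} \<in> E")
    \<comment> \<open>A lower arc repeated in \<open>E\<close> is connected by the copy in
      \<open>E\<close>; every other arc is connected by its copy in the upper half.\<close>
    case True
    then obtain a b where ab: "x = Lower a" "y = Lower b" "{Lower a, Lower b} \<in> E" by blast
    from imageI[OF ab(3), of "(`) lower_half"] show ?thesis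
      unfolding H_def using ab by (intro reach_arc) simp
  next
    case False
    have pts: "x \<in> points n" "y \<in> points n" using perfect_matching_subset[OF D xy] by auto
    have "\<nexists>a b. x = Lower b \<and> {Lower a, Lower b} \<in> D \<and> {Lower a, Lower b} \<in> E"
      using perfect_matching_mate_eq[OF D xy] False by (metis insert_commute)
    moreover have "\<nexists>a b. y = Lower b \<and> {Lower a, Lower b} \<in> D \<and> {Lower a, Lower b} \<in> E"
      using perfect_matching_mate_eq[OF D, of y x] xy False by (metis insert_commute)
    ultimately have "(upper_half x, outer x) \<in> (adjacency H)\<^sup>*" "(upper_half y, outer y) \<in> (adjacency H)\<^sup>*"
      using low pts by blast+
    moreover from imageI[OF xy, of "(`) upper_half"] have "(upper_half x, upper_half y) \<in> (adjacency H)\<^sup>*"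
      unfolding H_def by (intro reach_arc) simp
    ultimately show ?thesis by (meson reach_sym rtrancl_trans)
  qed
  moreover have "x \<noteq> y" if "{x, y} \<in> D" for x y using perfect_matching_neq[OF D that] .
  ultimately have "x \<noteq> y \<and> (outer x, outer y) \<in> (adjacency H)\<^sup>* \<longleftrightarrow> {x, y} \<in> D" for x y by metis
  then have "{{x, y} | x y. x \<noteq> y \<and> (outer x, outer y) \<in> (adjacency H)\<^sup>*} = {{x, y} | x y. {x, y} \<in> D}"
    by simp
  also have "\<dots> = D" using perfect_matching_pair[OF D] by blast
  finally show ?thesis unfolding stack_def stack_arcs_eq H_def .
qed

section \<open>Products with the identity and with \<open>e_i\<close>\<close>

lemma stack_id_diagram:
  assumes "D \<in> tl_diagrams n"
  shows "stack D (id_diagram n) = D" "loops n D (id_diagram n) = 0"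
proof -
  show "stack D (id_diagram n) = D"
    by (rule stack_absorb[OF tl_diagramsD(1)[OF assms] tl_diagramsD(1)[OF id_diagram_tl]])
      (auto simp: id_diagram_def)
  have "{C. (\<exists>m\<in>{1..n}. C = (stack_arcs D (id_diagram n))\<^sup>* `` {Mid m}) \<and> C \<subseteq> range Mid} = {}"
  proof -
    have "Bot m \<in> (stack_arcs D (id_diagram n))\<^sup>* `` {Mid m}" if "m \<in> {1..n}" for m
    proof -
      have "{Upper m, Lower m} \<in> id_diagram n" using that unfolding id_diagram_def by blast
      from imageI[OF this, of "(`) lower_half"] show ?thesis
        unfolding stack_arcs_eq by (simp add: reach_arc)
    qed
    then show ?thesis by blast
  qed
  then show "loops n D (id_diagram n) = 0" unfolding loops_def by (metis card.empty)
qed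

lemma e_diagram_eq_rewire:
  assumes "1 \<le> i" "i < n"
  shows "e_diagram n i = rewire (Lower i) (Lower (i + 1)) (id_diagram n)"
proof -
  define M where "M = {{Upper j, Lower j} | j. j \<in> {1..n} - {i, i + 1}}"
  have "id_diagram n = (\<lambda>j. {Upper j, Lower j}) ` {1..n}" "M = (\<lambda>j. {Upper j, Lower j}) ` ({1..n} - {i, i + 1})"
    unfolding id_diagram_def M_def by blast+
  moreover have "insert i (insert (i + 1) ({1..n} - {i, i + 1})) = {1..n}" using assms by auto
  ultimately have "id_diagram n = (\<lambda>j. {Upper j, Lower j}) ` insert i (insert (i + 1) ({1..n} - {i, i + 1}))"
    "M = (\<lambda>j. {Upper j, Lower j}) ` ({1..n} - {i, i + 1})" by simp_all
  then have "id_diagram n = insert {Lower i, Upper i} (insert {Lower (i + 1), Upper (i + 1)} M)"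
    by (simp only: image_insert insert_commute[of "Lower _"])
  moreover have "rewire (Lower i) (Lower (i + 1)) (insert {Lower i, Upper i} (insert {Lower (i + 1), Upper (i + 1)} M))
    = insert {Lower i, Lower (i + 1)} (insert {Upper i, Upper (i + 1)} M)"
    by (rule rewire_two_arcs) (auto simp: M_def)
  ultimately show ?thesis unfolding e_diagram_def M_def by auto
qed

lemma e_diagram_tl:
  assumes "1 \<le> i" "i < n" shows "e_diagram n i \<in> tl_diagrams n"
  unfolding e_diagram_eq_rewire[OF assms] using rewire_tl_diagrams[OF id_diagram_tl assms] .

lemma loops_e_diagram_cap:
  assumes "D \<in> tl_diagrams n" "1 \<le> i" "i < n" "{Lower i, Lower (i + 1)} \<in> D"
  shows "loops n D (e_diagram n i) = 1"
proof -
  define H where "H = (`) upper_half ` D \<union> (`) lower_half ` e_diagram n i"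
  have D: "perfect_matching (points n) D" using tl_diagramsD(1)[OF assms(1)] .
  have E: "perfect_matching (points n) (e_diagram n i)"
    using tl_diagramsD(1)[OF e_diagram_tl[OF assms(2,3)]] .
  have cap: "{Upper i, Upper (i + 1)} \<in> e_diagram n i" unfolding e_diagram_def by blast
  have capM: "component H (Mid m) = {Mid i, Mid (i + 1)}" if m: "m \<in> {i, i + 1}" for m
  proof
    show "component H (Mid m) \<subseteq> {Mid i, Mid (i + 1)}"
    proof (rule component_closed)
      fix u w assume u: "u \<in> {Mid i, Mid (i + 1)}" and "{u, w} \<in> H"
      then consider d where "d \<in> D" "{u, w} = upper_half ` d"
        | e where "e \<in> e_diagram n i" "{u, w} = lower_half ` e"
        unfolding H_def by blast
      then show "w \<in> {Mid i, Mid (i + 1)}"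
      proof cases
        case 1
        have "Lower i \<in> d \<or> Lower (i + 1) \<in> d"
        proof -
          obtain s where "s \<in> d" "upper_half s = u" using 1 by (metis imageE insertCI)
          then show ?thesis using u by (cases s) auto
        qed
        then have "d = {Lower i, Lower (i + 1)}" using perfect_matching_unique[OF D 1(1) assms(4)] by blast
        then show ?thesis using 1(2) by (auto simp: doubleton_eq_iff)
      next
        case 2
        have "Upper i \<in> e \<or> Upper (i + 1) \<in> e"
        proof -
          obtain s where "s \<in> e" "lower_half s = u" using 2 by (metis imageE insertCI)
          then show ?thesis using u by (cases s) auto
        qed
        then have "e = {Upper i, Upper (i + 1)}" using perfect_matching_unique[OF E 2(1) cap] by blast
        then show ?thesis using 2(2) by (auto simp: doubleton_eq_iff)
      qed
    qed (use m in auto)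
    have "{Mid i, Mid (i + 1)} \<in> H"
      using imageI[OF cap, of "(`) lower_half"] unfolding H_def by simp
    from reach_arc[OF this] show "{Mid i, Mid (i + 1)} \<subseteq> component H (Mid m)"
      using m reach_sym by auto
  qed
  have other: "Bot m \<in> component H (Mid m)" if m: "m \<in> {1..n}" "m \<notin> {i, i + 1}" for m
  proof -
    have "{Upper m, Lower m} \<in> e_diagram n i" using m unfolding e_diagram_def by blast
    from imageI[OF this, of "(`) lower_half"] show ?thesis
      unfolding H_def by (simp add: reach_arc)
  qed
  have "{C. (\<exists>m\<in>{1..n}. C = component H (Mid m)) \<and> C \<subseteq> range Mid} = {{Mid i, Mid (i + 1)}}"
  proof
    show "{{Mid i, Mid (i + 1)}} \<subseteq> {C. (\<exists>m\<in>{1..n}. C = component H (Mid m)) \<and> C \<subseteq> range Mid}"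
    proof -
      have "i \<in> {1..n}" "component H (Mid i) = {Mid i, Mid (i + 1)}" using capM[of i] assms(2,3) by simp_all
      then show ?thesis by blast
    qed
    show "{C. (\<exists>m\<in>{1..n}. C = component H (Mid m)) \<and> C \<subseteq> range Mid} \<subseteq> {{Mid i, Mid (i + 1)}}"
    proof
      fix C assume "C \<in> {C. (\<exists>m\<in>{1..n}. C = component H (Mid m)) \<and> C \<subseteq> range Mid}"
      then obtain m where m: "m \<in> {1..n}" "C = component H (Mid m)" "C \<subseteq> range Mid" by blast
      then have "m \<in> {i, i + 1}" using other[of m] by blast
      then show "C \<in> {{Mid i, Mid (i + 1)}}" using capM m by blast
    qed
  qed
  then show ?thesis unfolding loops_def stack_arcs_eq H_def by simp
qed

text \<open>As \<open>e_i\<close> has the upper cap, \<open>D\<close> may be replaced by its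
  rewiring without changing the stacked diagram; the rewired diagram has the lower cap and is
  absorbed. The loop count is read off by comparison with the single loop of the rewired
  picture.\<close>

lemma stack_e_diagram:
  assumes "D \<in> tl_diagrams n" "1 \<le> i" "i < n"
  shows "stack D (e_diagram n i) = rewire (Lower i) (Lower (i + 1)) D"
    and "loops n D (e_diagram n i) = (if {Lower i, Lower (i + 1)} \<in> D then 1 else 0)"
proof -
  let ?D = "rewire (Lower i) (Lower (i + 1)) D"
  have D': "?D \<in> tl_diagrams n" using rewire_tl_diagrams[OF assms] .
  have E: "e_diagram n i \<in> tl_diagrams n" using e_diagram_tl[OF assms(2,3)] .
  have cap: "{Upper i, Upper (i + 1)} \<in> e_diagram n i" unfolding e_diagram_def by blast
  have low: "{Lower i, Lower (i + 1)} \<in> ?D" by (rule arc_in_rewire)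
  have "stack ?D (e_diagram n i) = ?D"
    by (rule stack_absorb[OF tl_diagramsD(1)[OF D'] tl_diagramsD(1)[OF E]])
      (use low in \<open>auto simp: e_diagram_def\<close>)
  then show "stack D (e_diagram n i) = ?D"
    using stack_rewire(1)[OF tl_diagramsD(1)[OF assms(1)] tl_diagramsD(1)[OF E] assms(2,3) cap] by simp
  show "loops n D (e_diagram n i) = (if {Lower i, Lower (i + 1)} \<in> D then 1 else 0)"
    using stack_rewire(2)[OF tl_diagramsD(1)[OF assms(1)] tl_diagramsD(1)[OF E] assms(2,3) cap]
      loops_e_diagram_cap[OF D' assms(2,3) low] by simp
qed

section \<open>Reflection reverses products\<close>

fun flip_stack :: "stack_pt \<Rightarrow> stack_pt" where
  "flip_stack (Top j) = Bot j"
| "flip_stack (Mid j) = Mid j"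
| "flip_stack (Bot j) = Top j"

lemma flip_stack_flip_stack [simp]: "flip_stack (flip_stack x) = x"
  by (cases x) auto

lemma bij_flip_stack: "bij flip_stack"
  by (rule o_bij[of flip_stack]) auto

lemma component_flip:
  "(stack_arcs (flip D) (flip E))\<^sup>* `` {flip_stack v} = flip_stack ` ((stack_arcs E D)\<^sup>* `` {v})"
proof -
  have "upper_half (flip_pt x) = flip_stack (lower_half x)"
    "lower_half (flip_pt x) = flip_stack (upper_half x)" for x by (cases x; simp)+
  then have "(`) upper_half ` flip D \<union> (`) lower_half ` flip E
    = (`) flip_stack ` ((`) upper_half ` E \<union> (`) lower_half ` D)"
    unfolding flip_def by (simp add: image_Un image_image Un_commute)
  then show ?thesis unfolding stack_arcs_eq by (simp add: component_image_bij[OF bij_flip_stack])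
qed

lemma stack_flip: "stack (flip D) (flip E) = flip (stack E D)"
proof -
  have outer: "outer (flip_pt x) = flip_stack (outer x)" for x by (cases x) auto
  have "(flip_stack u, flip_stack v) \<in> (stack_arcs (flip D) (flip E))\<^sup>* \<longleftrightarrow> (u, v) \<in> (stack_arcs E D)\<^sup>*" for u v
  proof -
    have "flip_stack v \<in> flip_stack ` ((stack_arcs E D)\<^sup>* `` {u}) \<longleftrightarrow> v \<in> (stack_arcs E D)\<^sup>* `` {u}"
      by (rule inj_image_mem_iff[OF bij_is_inj[OF bij_flip_stack]])
    then show ?thesis unfolding component_flip[symmetric] by simp
  qed
  then have reach: "(outer (flip_pt x), outer (flip_pt y)) \<in> (stack_arcs (flip D) (flip E))\<^sup>*
    \<longleftrightarrow> (outer x, outer y) \<in> (stack_arcs E D)\<^sup>*" for x y unfolding outer by simp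
  show ?thesis
  proof
    show "flip (stack E D) \<subseteq> stack (flip D) (flip E)"
    proof
      fix c assume "c \<in> flip (stack E D)"
      then obtain x y where "c = {flip_pt x, flip_pt y}" "x \<noteq> y" "(outer x, outer y) \<in> (stack_arcs E D)\<^sup>*"
        unfolding flip_def stack_def by auto
      moreover from this have "flip_pt x \<noteq> flip_pt y" by (metis flip_pt_flip_pt)
      ultimately show "c \<in> stack (flip D) (flip E)" unfolding stack_def using reach by blast
    qed
    show "stack (flip D) (flip E) \<subseteq> flip (stack E D)"
    proof
      fix c assume "c \<in> stack (flip D) (flip E)"
      then obtain x y where c: "c = {x, y}" "x \<noteq> y" "(outer x, outer y) \<in> (stack_arcs (flip D) (flip E))\<^sup>*"
        unfolding stack_def by auto
      then have "(outer (flip_pt x), outer (flip_pt y)) \<in> (stack_arcs E D)\<^sup>*"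
        using reach[of "flip_pt x" "flip_pt y"] by simp
      moreover have "flip_pt x \<noteq> flip_pt y" using c(2) by (metis flip_pt_flip_pt)
      ultimately have "{flip_pt x, flip_pt y} \<in> stack E D" unfolding stack_def by blast
      from imageI[OF this, of "(`) flip_pt"] show "c \<in> flip (stack E D)" unfolding flip_def c by simp
    qed
  qed
qed

lemma loops_flip: "loops n (flip D) (flip E) = loops n E D"
proof -
  have comp: "(stack_arcs (flip D) (flip E))\<^sup>* `` {Mid m} = flip_stack ` ((stack_arcs E D)\<^sup>* `` {Mid m})" for m
    using component_flip[of D E "Mid m"] by simp
  have inj: "inj ((`) flip_stack)" 
    by (intro injI) (simp only: inj_image_eq_iff[OF bij_is_inj[OF bij_flip_stack]])
  have sub: "flip_stack ` C \<subseteq> range Mid \<longleftrightarrow> C \<subseteq> range Mid" for C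
  proof -
    have "flip_stack v \<in> range Mid \<longleftrightarrow> v \<in> range Mid" for v by (cases v) auto
    then show ?thesis by blast
  qed
  have "{C. (\<exists>m\<in>{1..n}. C = (stack_arcs (flip D) (flip E))\<^sup>* `` {Mid m}) \<and> C \<subseteq> range Mid}
    = (`) flip_stack ` {C. (\<exists>m\<in>{1..n}. C = (stack_arcs E D)\<^sup>* `` {Mid m}) \<and> C \<subseteq> range Mid}"
  proof -
    have *: "{C. (\<exists>m\<in>{1..n}. C = h m) \<and> C \<subseteq> range Mid} = h ` {m \<in> {1..n}. h m \<subseteq> range Mid}" for h :: "nat \<Rightarrow> stack_pt set"
      by blast
    show ?thesis unfolding comp * sub by (simp add: image_image)
  qed
  moreover have "card ((`) flip_stack ` K) = card K" for K
    by (rule card_image[OF inj_on_subset[OF inj subset_UNIV]])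
  ultimately show ?thesis unfolding loops_def by simp
qed

lemma flip_e_diagram [simp]: "flip (e_diagram n i) = e_diagram n i"
proof -
  have "{{Upper j, Lower j} | j. j \<in> {1..n} - {i, i + 1}} = (\<lambda>j. {Upper j, Lower j}) ` ({1..n} - {i, i + 1})"
    by blast
  then show ?thesis
    unfolding flip_def e_diagram_def by (simp add: image_Un image_image insert_commute)
qed

section \<open>The component form\<close>

text \<open>The number of closed curves obtained by gluing one diagram to the mirror image of the
  other along the whole boundary; the powers of the loop value with these exponents form the Gram
  matrix of the meander form.\<close>

definition component_count :: "'a set \<Rightarrow> 'a set set \<Rightarrow> 'a set set \<Rightarrow> nat" where
  "component_count A M N = card (component (M \<union> N) ` A)"

lemma component_count_commute: "component_count A M N = component_count A N M"
  unfolding component_count_def by (simp add: Un_commute)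

lemma component_count_rewire:
  assumes fin: "finite A" and M: "perfect_matching A M" and N: "perfect_matching A N"
    and cap: "{p, r} \<in> N"
  shows "component_count A M N + 1
    = component_count A (rewire p r M) N + (if {p, r} \<in> M then 1 else 0)"
proof (cases "{p, r} \<in> M")
  case True
  then show ?thesis using rewire_arc[OF M] by simp
next
  case False
  have pr: "p \<in> A" "r \<in> A" "p \<noteq> r"
    using perfect_matching_subset[OF N cap] perfect_matching_neq[OF N cap] by auto
  obtain x y M0 where xy: "x \<notin> {p, r}" "y \<notin> {p, r}" "x \<in> A"
    and M': "M = insert {p, x} (insert {r, y} M0)"
    and M0: "\<forall>c\<in>M0. c \<inter> {p, r, x, y} = {}"
    and rw: "rewire p r M = insert {p, r} (insert {x, y} M0)"
    using perfect_matching_two_arcs[OF M pr False] by metis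
  interpret rewired "M0 \<union> (N - {{p, r}})" p r x y
  proof
    fix c assume "c \<in> M0 \<union> (N - {{p, r}})"
    then consider "c \<in> M0" | "c \<in> N" "c \<noteq> {p, r}" by blast
    then show "p \<notin> c \<and> r \<notin> c"
    proof cases
      case 1
      then have "c \<inter> {p, r, x, y} = {}" using M0 by blast
      then show ?thesis by blast
    next
      case 2
      then show ?thesis using perfect_matching_unique[OF N 2(1) cap] by blast
    qed
  qed (use xy in auto)
  have "insert a (insert b M0) \<union> N = insert {p, r} (insert a (insert b (M0 \<union> (N - {{p, r}}))))"
    "insert {p, r} (insert b M0) \<union> N = insert {p, r} (insert b (M0 \<union> (N - {{p, r}})))" for a b
    using cap by blast+
  note union = this
  have "M \<union> N = H1" unfolding M' by (rule union)
  moreover have "rewire p r M \<union> N = H2" unfolding rw by (rule union)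
  moreover have "card {C. (\<exists>v\<in>A. C = component H2 v) \<and> C \<subseteq> UNIV}
      = card {C. (\<exists>v\<in>A. C = component H1 v) \<and> C \<subseteq> UNIV} + 1"
    by (rule card_components_rewired) (use fin pr xy in auto)
  moreover have "{C. (\<exists>v\<in>A. C = g v) \<and> C \<subseteq> UNIV} = g ` A" for g :: "'a \<Rightarrow> 'a set"
    by blast
  ultimately show ?thesis using False unfolding component_count_def by simp
qed

text \<open>Self-adjointness of \<open>e_i\<close>: both sides are compared with the count in which
  both matchings are rewired. The indicators stand for the loop that \<open>e_i\<close> closes off
  when the cap is already there.\<close>

lemma component_count_rewire_commute:
  assumes "finite A" "perfect_matching A M" "perfect_matching A N" "p \<in> A" "r \<in> A" "p \<noteq> r"
  shows "component_count A (rewire p r M) N + (if {p, r} \<in> M then 1 else 0)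
    = component_count A M (rewire p r N) + (if {p, r} \<in> N then 1 else 0)"
proof -
  have rw: "perfect_matching A (rewire p r M)" "perfect_matching A (rewire p r N)"
    using perfect_matching_rewire assms by metis+
  show ?thesis
    using component_count_rewire[OF assms(1,2) rw(2) arc_in_rewire]
      component_count_rewire[OF assms(1,3) rw(1) arc_in_rewire]
    by (simp add: component_count_commute)
qed

lemma component_count_self:
  assumes "perfect_matching A M"
  shows "component_count A M M = card M"
proof -
  have comp: "component M x = c" if cx: "c \<in> M" "x \<in> c" for x c
  proof
    show "component M x \<subseteq> c"
      by (rule component_closed) (use cx perfect_matching_unique[OF assms] in blast)+
    obtain a b where "c = {a, b}" using perfect_matching_pair[OF assms cx(1)] by metis
    then show "c \<subseteq> component M x" using cx reach_arc[of a b M] reach_sym[of a b M] by auto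
  qed
  have "component M ` A = M"
  proof
    show "component M ` A \<subseteq> M" 
    proof (rule image_subsetI)
      fix x assume "x \<in> A"
      then obtain y where "{x, y} \<in> M" using perfect_matching_mate[OF assms] by metis
      then show "component M x \<in> M" using comp[of "{x, y}" x] by simp
    qed
    show "M \<subseteq> component M ` A"
    proof
      fix c assume c: "c \<in> M"
      obtain a b where "c = {a, b}" using perfect_matching_pair[OF assms c] by metis
      then show "c \<in> component M ` A" using comp[OF c, of a] perfect_matching_subset[OF assms c] by blast
    qed
  qed
  then show ?thesis unfolding component_count_def by simp
qed

text \<open>Each component of the union is a union of arcs of \<open>M\<close>. If there were as
  many components as arcs, each component would be a single arc of \<open>M\<close>, and every arc
  of \<open>N\<close> would belong to \<open>M\<close>.\<close>

lemma component_count_less: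
  assumes fin: "finite A" and M: "perfect_matching A M" and N: "perfect_matching A N" and ne: "M \<noteq> N"
  shows "component_count A M N < component_count A M M"
proof -
  have finM: "finite M" by (rule finite_subset[of _ "Pow A"]) (use fin perfect_matching_subset[OF M] in auto)
  define g where "g c = component (M \<union> N) (SOME x. x \<in> c)" for c
  have g: "g c = component (M \<union> N) x" if cx: "c \<in> M" "x \<in> c" for c x
  proof -
    have s: "(SOME x. x \<in> c) \<in> c" using cx(2) by (rule someI)
    obtain a b where ab: "c = {a, b}" using perfect_matching_pair[OF M cx(1)] by metis
    then have "(a, b) \<in> (adjacency (M \<union> N))\<^sup>*" using cx by (intro reach_arc) simp
    then show ?thesis using s cx(2) reach_sym[of a b "M \<union> N"] ab
      unfolding g_def component_eq_iff by auto
  qed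
  have img: "g ` M = component (M \<union> N) ` A"
  proof
    show "g ` M \<subseteq> component (M \<union> N) ` A"
    proof (rule image_subsetI)
      fix c assume c: "c \<in> M"
      obtain a b where "c = {a, b}" using perfect_matching_pair[OF M c] by metis
      then show "g c \<in> component (M \<union> N) ` A"
        using g[OF c, of a] perfect_matching_subset[OF M c] by blast
    qed
    show "component (M \<union> N) ` A \<subseteq> g ` M"
    proof (rule image_subsetI)
      fix x assume "x \<in> A"
      then obtain y where y: "{x, y} \<in> M" using perfect_matching_mate[OF M] by metis
      then have "component (M \<union> N) x = g {x, y}" using g[of "{x, y}" x] by simp
      then show "component (M \<union> N) x \<in> g ` M" using y by blast
    qed
  qed
  have "\<not> inj_on g M"
  proof
    assume inj: "inj_on g M"
    have "N \<subseteq> M"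
    proof
      fix d assume d: "d \<in> N"
      obtain u v where uv: "d = {u, v}" "u \<noteq> v" using perfect_matching_pair[OF N d] by metis
      have "u \<in> A" "v \<in> A" using perfect_matching_subset[OF N d] uv by auto
      then obtain u' v' where c: "{u, u'} \<in> M" "{v, v'} \<in> M" using perfect_matching_mate[OF M] by metis
      have "(u, v) \<in> (adjacency (M \<union> N))\<^sup>*" using d uv by (intro reach_arc) simp
      then have "g {u, u'} = g {v, v'}"
        using g[OF c(1), of u] g[OF c(2), of v] component_eq_iff[of "M \<union> N" u v] by simp
      then have "{u, u'} = {v, v'}" using inj_onD[OF inj] c by metis
      then have "{u, u'} = {u, v}" using uv(2) by (auto simp: doubleton_eq_iff)
      then show "d \<in> M" using c uv by simp
    qed
    then show False using perfect_matching_subset_eq[OF M N] ne by simp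
  qed
  then have "card (g ` M) < card M"
    using card_image_le[OF finM, of g] eq_card_imp_inj_on[OF finM, of g] by linarith
  then show ?thesis using component_count_self[OF M] unfolding img component_count_def by simp
qed

lemma component_count_flip:
  "component_count (points n) (flip D) (flip E) = component_count (points n) D E"
proof -
  have pts: "flip_pt ` points n = points n" by (auto simp: points_def image_Un image_image)
  have inj: "inj ((`) flip_pt)" by (intro injI) (simp only: inj_image_eq_iff[OF bij_is_inj[OF bij_flip_pt]])
  have "component (flip D \<union> flip E) (flip_pt v) = flip_pt ` component (D \<union> E) v" for v
    using component_image_bij[OF bij_flip_pt, of "D \<union> E" v] unfolding flip_def image_Un .
  then have "component (flip D \<union> flip E) ` points n = (`) flip_pt ` component (D \<union> E) ` points n"
    by (subst pts[symmetric]) (simp only: image_image)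
  then show ?thesis unfolding component_count_def
    using card_image[OF inj_on_subset[OF inj subset_UNIV]] by simp
qed

section \<open>Linear algebra over rational functions in \<open>q\<close>\<close>

lemma nonzero_solution:
  fixes g :: "'b \<Rightarrow> 'a \<Rightarrow> 'k :: field"
  assumes "finite B" "finite A" "card B < card A"
  shows "\<exists>f. (\<exists>a\<in>A. f a \<noteq> 0) \<and> (\<forall>b\<in>B. (\<Sum>a\<in>A. g b a * f a) = 0)"
  using assms
proof (induction B arbitrary: A g rule: finite_induct)
  case empty
  then obtain a where "a \<in> A" by fastforce
  then show ?case by (intro exI[of _ "\<lambda>_. 1"]) auto
next
  case (insert b B)
  show ?case
  proof (cases "\<forall>a\<in>A. g b a = 0")
    case True
    have "card B < card A" using insert by simp
    then show ?thesis using insert.IH[of A g] insert.prems True by auto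
  next
    case False
    then obtain a0 where a0: "a0 \<in> A" "g b a0 \<noteq> 0" by blast
    \<comment> \<open>The unknown at \<open>a0\<close> is eliminated with the pivot
      \<open>g b a0\<close>; its value is recovered afterwards from equation
      \<open>b\<close>.\<close>
    let ?h = "\<lambda>c a. g c a - g c a0 * g b a / g b a0"
    have "card B < card (A - {a0})" "finite (A - {a0})" using insert a0 by auto
    then obtain f where f: "\<exists>a\<in>A - {a0}. f a \<noteq> 0"
      "\<And>c. c \<in> B \<Longrightarrow> (\<Sum>a\<in>A - {a0}. ?h c a * f a) = 0"
      using insert.IH[of "A - {a0}" ?h] by blast
    define s where "s = (\<Sum>a\<in>A - {a0}. g b a * f a)"
    define f' where "f' = f(a0 := - s / g b a0)"
    have split: "(\<Sum>a\<in>A. g c a * f' a) = (\<Sum>a\<in>A - {a0}. g c a * f a) - g c a0 * s / g b a0" for c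
    proof -
      have "(\<Sum>a\<in>A. g c a * f' a) = g c a0 * f' a0 + (\<Sum>a\<in>A - {a0}. g c a * f' a)"
        using sum.remove[OF insert.prems(1) a0(1)] .
      also have "(\<Sum>a\<in>A - {a0}. g c a * f' a) = (\<Sum>a\<in>A - {a0}. g c a * f a)"
        by (rule sum.cong) (auto simp: f'_def)
      finally show ?thesis by (simp add: f'_def)
    qed
    have "(\<Sum>a\<in>A. g c a * f' a) = 0" if "c \<in> insert b B" for c
    proof (cases "c = b")
      case True
      then show ?thesis unfolding split s_def using a0 by simp
    next
      case False
      then have "0 = (\<Sum>a\<in>A - {a0}. ?h c a * f a)" using f(2) that by simp
      also have "\<dots> = (\<Sum>a\<in>A - {a0}. g c a * f a) - g c a0 / g b a0 * s"
        unfolding s_def sum_distrib_left sum_subtractf[symmetric]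
        by (rule sum.cong) (auto simp: field_simps)
      finally show ?thesis unfolding split by simp
    qed
    moreover have "\<exists>a\<in>A. f' a \<noteq> 0" using f(1) unfolding f'_def by auto
    ultimately show ?thesis by blast
  qed
qed

lemma common_denominator:
  fixes x :: "'a \<Rightarrow> 'k :: idom fract"
  assumes "finite S"
  obtains d p where "d \<noteq> 0" "\<And>a. a \<in> S \<Longrightarrow> to_fract d * x a = to_fract (p a)"
proof -
  have "\<exists>u v. v \<noteq> 0 \<and> to_fract v * x a = to_fract u" for a
  proof (cases "x a")
    case (Fract u v)
    then show ?thesis by (intro exI[of _ u] exI[of _ v]) (simp add: to_fract_def eq_fract)
  qed
  then obtain u v where uv: "\<And>a. v a \<noteq> 0" "\<And>a. to_fract (v a) * x a = to_fract (u a)" by metis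
  show ?thesis
  proof (rule that[of "\<Prod>a\<in>S. v a" "\<lambda>a. (\<Prod>b\<in>S - {a}. v b) * u a"])
    show "(\<Prod>a\<in>S. v a) \<noteq> 0" using uv(1) assms by simp
    fix a assume "a \<in> S"
    then have "(\<Prod>a\<in>S. v a) = v a * (\<Prod>b\<in>S - {a}. v b)" by (rule prod.remove[OF assms])
    then show "to_fract (\<Prod>a\<in>S. v a) * x a = to_fract ((\<Prod>b\<in>S - {a}. v b) * u a)"
      using uv(2)[of a] by (simp add: ac_simps)
  qed
qed

lemma qvar_nonzero: "qvar \<noteq> 0" 
  unfolding qvar_def by (simp add: Zero_fract_def eq_fract)

lemma qvar_eq: "qvar = to_fract [:0, 1:]"
  unfolding qvar_def to_fract_def ..

lemma qvar_neq_inverse: "qvar - inverse qvar \<noteq> 0"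
proof
  assume "qvar - inverse qvar = 0"
  then have "qvar * qvar = 1" using qvar_nonzero by (metis eq_iff_diff_eq_0 right_inverse)
  then have "to_fract ([:0, 1:] * [:0, 1:] :: complex poly) = to_fract 1"
    unfolding qvar_eq by (simp only: to_fract_mult to_fract_1)
  then show False unfolding to_fract_eq_iff by (simp add: one_pCons)
qed

lemma qint_0 [simp]: "qint 0 = 0" and qint_1 [simp]: "qint (Suc 0) = 1"
  using qvar_neq_inverse unfolding qint_def by simp_all

lemma qint_Suc_Suc: "qint (Suc (Suc m)) = qint 2 * qint (Suc m) - qint m"
proof -
  let ?q = qvar
  have "(?q ^ 2 - inverse ?q ^ 2) * (?q ^ Suc m - inverse ?q ^ Suc m)
    = (?q - inverse ?q) * ((?q ^ Suc (Suc m) - inverse ?q ^ Suc (Suc m)) + (?q ^ m - inverse ?q ^ m))"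
    using qvar_nonzero by (simp add: field_simps power2_eq_square)
  then show ?thesis
    using qvar_neq_inverse unfolding qint_def by (simp add: divide_simps)
qed

lemma qint_2: "qint 2 * qvar = qvar ^ 2 + 1"
proof -
  have "qint 2 = qvar + inverse qvar"
    using qvar_neq_inverse unfolding qint_def by (simp add: divide_simps power2_eq_square algebra_simps)
  then show ?thesis using qvar_nonzero by (simp add: field_simps power2_eq_square)
qed

text \<open>One factor \<open>qvar\<close> clears the denominator and leaves a polynomial of degree
  2. Hence the loop value to the power \<open>e\<close>, times \<open>qvar ^ K\<close> with
  \<open>e \<le> K\<close>, is a polynomial of degree \<open>K + e\<close>.\<close>

lemma loop_value_eq: "(- qint 2) * qvar = to_fract (- [:1, 0, 1:])"
proof -
  have "- [:1, 0, 1:] = - ([:0, 1:] * [:0, 1:] + (1 :: complex poly))"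
    by (simp add: one_pCons)
  then have "to_fract (- [:1, 0, 1:]) = - (qvar ^ 2 + 1)"
    unfolding qvar_eq power2_eq_square
    by (simp only: to_fract_uminus to_fract_add to_fract_mult to_fract_1)
  then show ?thesis using qint_2 by simp
qed

lemma loop_value_nonzero: "- qint 2 \<noteq> 0"
proof
  assume "- qint 2 = 0"
  then have "to_fract (- [:1, 0, 1:] :: complex poly) = to_fract 0" using loop_value_eq by simp
  then show False unfolding to_fract_eq_iff by simp
qed

text \<open>After clearing denominators, choose \<open>c\<close> with \<open>p c\<close> of largest
  degree. In row \<open>c\<close> the diagonal exponent is strictly the largest, so the degree of
  the diagonal term exceeds that of all other terms and its leading coefficient cannot
  cancel.\<close>

lemma loop_power_matrix_nondegenerate:
  fixes x :: "'a \<Rightarrow> ratfun" and e :: "'a \<Rightarrow> 'a \<Rightarrow> nat"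
  assumes fin: "finite S"
    and dom: "\<And>a b. a \<in> S \<Longrightarrow> b \<in> S \<Longrightarrow> a \<noteq> b \<Longrightarrow> e a b < e a a"
    and zero: "\<And>a. a \<in> S \<Longrightarrow> (\<Sum>b\<in>S. x b * (- qint 2) ^ e a b) = 0"
    and a: "a \<in> S"
  shows "x a = 0"
proof -
  obtain d p where d: "d \<noteq> 0" and p: "\<And>a. a \<in> S \<Longrightarrow> to_fract d * x a = to_fract (p a)"
    using common_denominator[OF fin] by metis
  have "p a = 0" if "a \<in> S" for a
  proof (rule ccontr)
    assume "p a \<noteq> 0"
    \<comment> \<open>The zero polynomial has degree 0 by convention, so the maximum is taken over
      nonzero entries only.\<close>
    define T where "T = {b \<in> S. p b \<noteq> 0}"
    have T: "finite T" "T \<noteq> {}" using fin \<open>p a \<noteq> 0\<close> that unfolding T_def by auto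
    have "Max ((\<lambda>b. degree (p b)) ` T) \<in> (\<lambda>b. degree (p b)) ` T"
      by (rule Max_in) (use T in auto)
    then obtain c where cT: "c \<in> T" and Max: "Max ((\<lambda>b. degree (p b)) ` T) = degree (p c)" by blast
    have cmax: "degree (p b) \<le> degree (p c)" if "b \<in> T" for b
      unfolding Max[symmetric] by (rule Max_ge) (use T that in auto)
    have c: "c \<in> S" "p c \<noteq> 0" using cT unfolding T_def by auto
    define K where "K = e c c"
    define P Q where "P = (- [:1, 0, 1:] :: complex poly)" and "Q = ([:0, 1:] :: complex poly)"
    have le: "e c b \<le> K" if "b \<in> S" for b using dom[OF c(1) that] unfolding K_def by fastforce
    have deg: "degree (P ^ m) = 2 * m" "degree (Q ^ m) = m" "P \<noteq> 0" "Q \<noteq> 0" for m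
      unfolding P_def Q_def by (simp_all add: degree_power_eq)
    have summand: "to_fract d * (x b * (- qint 2) ^ e c b) * qvar ^ K
        = to_fract (p b * P ^ e c b * Q ^ (K - e c b))" if "b \<in> S" for b
    proof -
      have "qvar ^ K = qvar ^ e c b * qvar ^ (K - e c b)"
        using le[OF that] by (metis le_add_diff_inverse power_add)
      then have "to_fract d * (x b * (- qint 2) ^ e c b) * qvar ^ K
          = (to_fract d * x b) * ((- qint 2) * qvar) ^ e c b * qvar ^ (K - e c b)"
        by (simp only: power_mult_distrib ac_simps)
      also have "\<dots> = to_fract (p b) * to_fract P ^ e c b * to_fract Q ^ (K - e c b)"
        unfolding p[OF that] loop_value_eq P_def Q_def by (simp only: qvar_eq)
      also have "\<dots> = to_fract (p b * P ^ e c b * Q ^ (K - e c b))"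
      proof -
        have "to_fract (r ^ m) = to_fract r ^ m" for r :: "complex poly" and m
          by (induction m) auto
        then show ?thesis by simp
      qed
      finally show ?thesis .
    qed
    have "to_fract (\<Sum>b\<in>S. p b * P ^ e c b * Q ^ (K - e c b))
        = (\<Sum>b\<in>S. to_fract (p b * P ^ e c b * Q ^ (K - e c b)))"
      using fin by (induction S rule: finite_induct) auto
    also have "\<dots> = to_fract d * (\<Sum>b\<in>S. x b * (- qint 2) ^ e c b) * qvar ^ K"
      unfolding sum_distrib_left sum_distrib_right using summand by (intro sum.cong) auto
    also have "\<dots> = to_fract 0" using zero[OF c(1)] by simp
    finally have sum0: "(\<Sum>b\<in>S. p b * P ^ e c b * Q ^ (K - e c b)) = 0" unfolding to_fract_eq_iff .
    define t where "t b = p b * P ^ e c b * Q ^ (K - e c b)" for b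
    have tc: "t c \<noteq> 0" "degree (t c) = degree (p c) + 2 * K"
      using c deg unfolding t_def K_def by (simp_all add: degree_mult_eq)
    have small: "coeff (t b) (degree (p c) + 2 * K) = 0" if "b \<in> S - {c}" for b
    proof (cases "p b = 0")
      case True
      then show ?thesis by (simp add: t_def)
    next
      case False
      have lt: "e c b < K" using dom[OF c(1)] that unfolding K_def by blast
      have "degree (t b) = degree (p b) + 2 * e c b + (K - e c b)"
        using False deg unfolding t_def by (simp add: degree_mult_eq)
      also have "\<dots> < degree (p c) + 2 * K"
        using cmax[of b] lt False that unfolding T_def by auto
      finally show ?thesis by (rule coeff_eq_0)
    qed
    have "0 = coeff (\<Sum>b\<in>S. t b) (degree (p c) + 2 * K)" using sum0 unfolding t_def by simp
    also have "\<dots> = (\<Sum>b\<in>S. coeff (t b) (degree (p c) + 2 * K))" by (simp add: coeff_sum)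
    also have "\<dots> = coeff (t c) (degree (p c) + 2 * K)"
      using sum.remove[OF fin c(1), of "\<lambda>b. coeff (t b) (degree (p c) + 2 * K)"] small
      by (simp add: sum.neutral)
    finally show False using tc by (metis leading_coeff_0_iff)
  qed
  then have "to_fract d * x a = 0" using p[OF a] a by simp
  then show ?thesis using d by simp
qed

section \<open>The Jones--Wenzl idempotent\<close>

abbreviation loop_value :: ratfun where
  "loop_value \<equiv> - qint 2"

section \<open>Coefficients of products\<close>

lemma basis_simps [simp]: "basis D D = 1" "D \<noteq> F \<Longrightarrow> basis D F = 0"
  unfolding basis_def by auto

lemma sum_basis:
  assumes "finite T" "E \<in> T"
  shows "(\<Sum>F\<in>T. basis E F * g F) = g E"
proof -
  have "(\<Sum>F\<in>T. basis E F * g F) = (\<Sum>F\<in>T. if F = E then g F else 0)"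
    by (rule sum.cong) (auto simp: basis_def)
  then show ?thesis using assms by simp
qed

text \<open>The linear functional \<open>g\<close> evaluated on the image of the combination
  \<open>a\<close> under a map \<open>r\<close> of basis elements.\<close>

lemma sum_pushforward:
  assumes "finite T" "\<And>D. D \<in> T \<Longrightarrow> r D \<in> T"
  shows "(\<Sum>D\<in>T. a D * g (r D)) = (\<Sum>F\<in>T. (\<Sum>D\<in>T. a D * basis (r D) F) * g F)"
proof -
  have "(\<Sum>F\<in>T. (\<Sum>D\<in>T. a D * basis (r D) F) * g F)
      = (\<Sum>D\<in>T. \<Sum>F\<in>T. a D * basis (r D) F * g F)"
    unfolding sum_distrib_right by (rule sum.swap)
  also have "\<dots> = (\<Sum>D\<in>T. a D * g (r D))"
    unfolding mult.assoc sum_distrib_left[symmetric] using sum_basis[OF assms(1)] assms(2)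
    by (intro sum.cong) auto
  finally show ?thesis ..
qed

lemma tl_mult_basis_right:
  assumes "E \<in> tl_diagrams n"
  shows "tl_mult n f (basis E) F
    = (\<Sum>D\<in>tl_diagrams n. f D * loop_value ^ loops n D E * basis (stack D E) F)"
proof -
  have "(\<Sum>E'\<in>tl_diagrams n. f D * basis E E' * loop_value ^ loops n D E' * basis (stack D E') F)
    = f D * loop_value ^ loops n D E * basis (stack D E) F" for D
    using sum_basis[OF finite_tl_diagrams assms, of "\<lambda>E'. f D * loop_value ^ loops n D E' * basis (stack D E') F"]
    by (simp only: ac_simps)
  then show ?thesis unfolding tl_mult_def by simp
qed

lemma tl_mult_basis_left:
  assumes "E \<in> tl_diagrams n"
  shows "tl_mult n (basis E) f F
    = (\<Sum>D\<in>tl_diagrams n. f D * loop_value ^ loops n E D * basis (stack E D) F)"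
proof -
  have "(\<Sum>E'\<in>tl_diagrams n. basis E E' * f D * loop_value ^ loops n E' D * basis (stack E' D) F)
    = f D * loop_value ^ loops n E D * basis (stack E D) F" for D
    using sum_basis[OF finite_tl_diagrams assms, of "\<lambda>E'. f D * loop_value ^ loops n E' D * basis (stack E' D) F"]
    by (simp only: ac_simps)
  then show ?thesis unfolding tl_mult_def by (subst sum.swap) simp
qed

section \<open>Annihilation by caps as orthogonality\<close>

abbreviation has_lower_cap :: "nat \<Rightarrow> diagram \<Rightarrow> nat" where
  "has_lower_cap i D \<equiv> (if {Lower i, Lower (i + 1)} \<in> D then 1 else 0)"

lemma tl_mult_e_diagram:
  assumes "1 \<le> i" "i < n"
  shows "tl_mult n f (basis (e_diagram n i)) F = (\<Sum>D\<in>tl_diagrams n.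
    f D * loop_value ^ has_lower_cap i D * basis (rewire (Lower i) (Lower (i + 1)) D) F)"
  unfolding tl_mult_basis_right[OF e_diagram_tl[OF assms]]
  by (rule sum.cong) (simp_all only: stack_e_diagram[OF _ assms])

text \<open>Only the condition on the right, which drives the orthogonality argument; for the
  element constructed below, the one on the left follows by reflection.\<close>

definition killed_by_caps :: "nat \<Rightarrow> tl \<Rightarrow> bool" where
  "killed_by_caps n f \<longleftrightarrow> (\<forall>i. 1 \<le> i \<and> i < n \<longrightarrow> tl_mult n f (basis (e_diagram n i)) = (\<lambda>_. 0))"

definition pairing :: "nat \<Rightarrow> tl \<Rightarrow> diagram \<Rightarrow> ratfun" where
  "pairing n f E = (\<Sum>D\<in>tl_diagrams n. f D * loop_value ^ component_count (points n) E D)"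

text \<open>Every linear functional \<open>g\<close> vanishes on \<open>f e_i = 0\<close>. It is
  used with the form and with the coefficients of a product as \<open>g\<close>.\<close>

lemma killed_by_caps_pushforward:
  assumes "killed_by_caps n f" "1 \<le> i" "i < n"
  shows "(\<Sum>D\<in>tl_diagrams n. f D * loop_value ^ has_lower_cap i D
    * g (rewire (Lower i) (Lower (i + 1)) D)) = 0"
proof -
  have "(\<Sum>D\<in>tl_diagrams n. f D * loop_value ^ has_lower_cap i D
      * g (rewire (Lower i) (Lower (i + 1)) D))
    = (\<Sum>F\<in>tl_diagrams n. tl_mult n f (basis (e_diagram n i)) F * g F)"
    unfolding tl_mult_e_diagram[OF assms(2,3)]
    by (rule sum_pushforward[OF finite_tl_diagrams rewire_tl_diagrams[OF _ assms(2,3)]])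
  then show ?thesis using assms unfolding killed_by_caps_def by simp
qed

text \<open>A lower cap in \<open>E\<close> absorbs \<open>e_i\<close> at the price of one loop
  value. So the loop value times the pairing of \<open>f\<close> with \<open>E\<close> is the
  pairing of \<open>f e_i = 0\<close> with \<open>E\<close>.\<close>

lemma pairing_lower_cap:
  assumes f: "killed_by_caps n f" and E: "E \<in> tl_diagrams n"
    and i: "1 \<le> i" "i < n" "{Lower i, Lower (i + 1)} \<in> E"
  shows "pairing n f E = 0"
proof -
  have "loop_value * pairing n f E = (\<Sum>D\<in>tl_diagrams n. f D * loop_value ^ has_lower_cap i D
    * loop_value ^ component_count (points n) (rewire (Lower i) (Lower (i + 1)) D) E)"
    unfolding pairing_def sum_distrib_left
  proof (rule sum.cong)
    fix D assume "D \<in> tl_diagrams n"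
    from component_count_rewire[OF finite_points tl_diagramsD(1)[OF this] tl_diagramsD(1)[OF E] i(3)]
    have "component_count (points n) E D + 1 = has_lower_cap i D
      + component_count (points n) (rewire (Lower i) (Lower (i + 1)) D) E"
      by (simp only: component_count_commute[of _ E D] add.commute)
    then have "loop_value ^ (component_count (points n) E D + 1) = loop_value ^ has_lower_cap i D
      * loop_value ^ component_count (points n) (rewire (Lower i) (Lower (i + 1)) D) E"
      by (simp only: power_add)
    then show "loop_value * (f D * loop_value ^ component_count (points n) E D)
      = f D * loop_value ^ has_lower_cap i D
        * loop_value ^ component_count (points n) (rewire (Lower i) (Lower (i + 1)) D) E"
      by (simp only: power_add power_one_right mult.assoc mult.left_commute mult.commute)
  qed simp
  also have "\<dots> = 0" by (rule killed_by_caps_pushforward[OF f i(1,2)])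
  finally have "loop_value = 0 \<or> pairing n f E = 0" by (simp only: mult_eq_0_iff)
  then show ?thesis using loop_value_nonzero by blast
qed

lemma pairing_eq_0:
  assumes "killed_by_caps n f" "E \<in> tl_diagrams n" "E \<noteq> id_diagram n"
  shows "pairing n f E = 0"
  using lower_cap_exists[OF assms(2,3)] pairing_lower_cap[OF assms(1,2)] by metis

text \<open>\<open>(f e_i) E\<close> is the loop value times \<open>f E\<close>, because the caps of
  \<open>e_i\<close> and \<open>E\<close> close up to a loop. Comparing the sums term by term takes
  the place of associativity.\<close>

lemma tl_mult_upper_cap:
  assumes f: "killed_by_caps n f" and E: "E \<in> tl_diagrams n"
    and i: "1 \<le> i" "i < n" "{Upper i, Upper (i + 1)} \<in> E"
  shows "(\<Sum>D\<in>tl_diagrams n. f D * loop_value ^ loops n D E * basis (stack D E) F) = 0"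
    (is "?s = 0")
proof -
  let ?g = "\<lambda>D. loop_value ^ loops n D E * basis (stack D E) F"
  have "loop_value * ?s = (\<Sum>D\<in>tl_diagrams n. f D * loop_value ^ has_lower_cap i D
    * ?g (rewire (Lower i) (Lower (i + 1)) D))"
    unfolding sum_distrib_left
  proof (rule sum.cong)
    fix D assume D: "D \<in> tl_diagrams n"
    let ?D = "rewire (Lower i) (Lower (i + 1)) D"
    note rw = stack_rewire[OF tl_diagramsD(1)[OF D] tl_diagramsD(1)[OF E] i]
    have "loop_value * (f D * loop_value ^ loops n D E * basis (stack D E) F)
      = f D * loop_value ^ (loops n D E + 1) * basis (stack D E) F"
      by (simp only: power_add power_one_right ac_simps)
    also have "\<dots> = f D * (loop_value ^ loops n ?D E * loop_value ^ has_lower_cap i D) * basis (stack ?D E) F"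
      unfolding rw by (simp only: power_add)
    also have "\<dots> = f D * loop_value ^ has_lower_cap i D * ?g ?D" by (simp only: ac_simps)
    finally show "loop_value * (f D * loop_value ^ loops n D E * basis (stack D E) F)
      = f D * loop_value ^ has_lower_cap i D * ?g ?D" .
  qed simp
  also have "\<dots> = 0" by (rule killed_by_caps_pushforward[OF f i(1,2)])
  finally have "loop_value = 0 \<or> ?s = 0" by (simp only: mult_eq_0_iff)
  then show ?thesis using loop_value_nonzero by blast
qed

text \<open>Every non-identity diagram has an upper cap and contributes nothing. The formula makes
  \<open>f\<close> idempotent if its identity coefficient is 1, and conversely forces this value for
  a nonzero idempotent.\<close>

lemma tl_mult_killed_by_caps:
  assumes f: "killed_by_caps n f" "f \<in> tl_carrier n"
  shows "tl_mult n f g = (\<lambda>F. g (id_diagram n) * f F)"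
proof
  fix F
  let ?s = "\<lambda>E. \<Sum>D\<in>tl_diagrams n. f D * loop_value ^ loops n D E * basis (stack D E) F"
  have "tl_mult n f g F = (\<Sum>E\<in>tl_diagrams n. g E * ?s E)"
    unfolding tl_mult_def sum_distrib_left by (subst sum.swap) (simp only: ac_simps)
  also have "\<dots> = (\<Sum>E\<in>tl_diagrams n. if E = id_diagram n then g E * ?s E else 0)"
  proof (rule sum.cong)
    fix E assume E: "E \<in> tl_diagrams n"
    show "g E * ?s E = (if E = id_diagram n then g E * ?s E else 0)"
    proof (cases "E = id_diagram n")
      case False
      then obtain i where "1 \<le> i" "i < n" "{Upper i, Upper (i + 1)} \<in> E"
        using upper_cap_exists[OF E] by metis
      then show ?thesis using tl_mult_upper_cap[OF f(1) E] False by simp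
    qed simp
  qed simp
  also have "\<dots> = g (id_diagram n) * ?s (id_diagram n)"
    using finite_tl_diagrams id_diagram_tl by simp
  also have "?s (id_diagram n) = (\<Sum>D\<in>tl_diagrams n. f D * basis D F)"
    by (rule sum.cong) (simp_all add: stack_id_diagram)
  also have "\<dots> = (\<Sum>D\<in>tl_diagrams n. if D = F then f D else 0)"
    by (rule sum.cong) (auto simp: basis_def)
  also have "\<dots> = f F" using f(2) finite_tl_diagrams unfolding tl_carrier_def by simp
  finally show "tl_mult n f g F = g (id_diagram n) * f F" .
qed

text \<open>Strict dominance of the diagonal passes to every principal submatrix. \<open>S\<close>
  will be the set of all diagrams, or of those other than the identity.\<close>

lemma pairing_nondegenerate:
  assumes "S \<subseteq> tl_diagrams n"
    and "\<And>D. D \<in> tl_diagrams n - S \<Longrightarrow> f D = 0" "\<And>E. E \<in> S \<Longrightarrow> pairing n f E = 0"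
    and D: "D \<in> tl_diagrams n"
  shows "f D = 0"
proof (cases "D \<in> S")
  case True
  show ?thesis
  proof (rule loop_power_matrix_nondegenerate[where S = S and e = "component_count (points n)"])
    show "finite S" using assms(1) finite_tl_diagrams finite_subset by blast
    show "component_count (points n) a b < component_count (points n) a a"
      if "a \<in> S" "b \<in> S" "a \<noteq> b" for a b
      using that assms(1) component_count_less[OF finite_points] tl_diagramsD(1) by blast
    fix E assume "E \<in> S"
    then have "0 = pairing n f E" using assms(3) by simp
    also have "\<dots> = (\<Sum>D\<in>S. f D * loop_value ^ component_count (points n) E D)"
      unfolding pairing_def by (rule sum.mono_neutral_right) (use assms finite_tl_diagrams in auto)
    finally show "(\<Sum>D\<in>S. f D * loop_value ^ component_count (points n) E D) = 0" ..
  qed (rule True)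
qed (use assms in blast)

text \<open>The difference has no identity term, so it lies in the span of the non-identity
  diagrams, where the form is nondegenerate too.\<close>

lemma pairing_unique:
  assumes "\<And>E. E \<in> tl_diagrams n \<Longrightarrow> E \<noteq> id_diagram n \<Longrightarrow> pairing n f E = pairing n g E"
    and "f (id_diagram n) = g (id_diagram n)" and "D \<in> tl_diagrams n"
  shows "f D = g D"
proof -
  have "f D - g D = 0"
  proof (rule pairing_nondegenerate[where S = "tl_diagrams n - {id_diagram n}" and f = "\<lambda>D. f D - g D"])
    show "pairing n (\<lambda>D. f D - g D) E = 0" if "E \<in> tl_diagrams n - {id_diagram n}" for E
      using assms(1)[of E] that unfolding pairing_def by (simp add: left_diff_distrib sum_subtractf)
  qed (use assms in auto)
  then show ?thesis by simp
qed

lemma id_diagram_no_cap: "{Lower i, Lower j} \<notin> id_diagram n"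
  unfolding id_diagram_def by (auto simp: doubleton_eq_iff)

text \<open>By adjointness, the pairing of \<open>f e_i\<close> with \<open>E\<close> is a multiple
  of the pairing of \<open>f\<close> with the rewired \<open>E\<close>, which has a lower cap and
  hence is not the identity. Nondegeneracy on all diagrams gives \<open>f e_i = 0\<close>.\<close>

lemma killed_by_capsI:
  assumes "\<And>E. E \<in> tl_diagrams n \<Longrightarrow> E \<noteq> id_diagram n \<Longrightarrow> pairing n f E = 0"
  shows "killed_by_caps n f"
  unfolding killed_by_caps_def
proof (intro allI impI ext)
  fix i F assume "1 \<le> i \<and> i < n"
  then have i: "1 \<le> i" "i < n" by auto
  let ?r = "rewire (Lower i) (Lower (i + 1))"
  let ?g = "tl_mult n f (basis (e_diagram n i))"
  let ?c = "component_count (points n)"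
  show "?g F = 0"
  proof (cases "F \<in> tl_diagrams n")
    case True
    show ?thesis
    proof (rule pairing_nondegenerate[OF subset_refl _ _ True])
      fix E assume E: "E \<in> tl_diagrams n"
      have "pairing n ?g E = (\<Sum>D\<in>tl_diagrams n. f D * loop_value ^ has_lower_cap i D * loop_value ^ ?c E (?r D))"
        unfolding pairing_def tl_mult_e_diagram[OF i]
        by (rule sum_pushforward[symmetric, OF finite_tl_diagrams rewire_tl_diagrams[OF _ i]])
      also have "\<dots> = (\<Sum>D\<in>tl_diagrams n. loop_value ^ has_lower_cap i E * (f D * loop_value ^ ?c (?r E) D))"
      proof (rule sum.cong)
        fix D assume D: "D \<in> tl_diagrams n"
        have "?c (?r E) D + has_lower_cap i E = ?c E (?r D) + has_lower_cap i D"
          by (rule component_count_rewire_commute[OF finite_points tl_diagramsD(1)[OF E] tl_diagramsD(1)[OF D]])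
            (use i in \<open>auto simp: points_def\<close>)
        then have "loop_value ^ ?c (?r E) D * loop_value ^ has_lower_cap i E
          = loop_value ^ ?c E (?r D) * loop_value ^ has_lower_cap i D"
          by (simp only: power_add[symmetric])
        then show "f D * loop_value ^ has_lower_cap i D * loop_value ^ ?c E (?r D)
          = loop_value ^ has_lower_cap i E * (f D * loop_value ^ ?c (?r E) D)"
          by (simp only: mult.assoc mult.left_commute mult.commute)
      qed simp
      also have "\<dots> = loop_value ^ has_lower_cap i E * pairing n f (?r E)"
        unfolding pairing_def sum_distrib_left ..
      also have "pairing n f (?r E) = 0"
        using assms rewire_tl_diagrams[OF E i] arc_in_rewire id_diagram_no_cap by metis
      finally show "pairing n ?g E = 0" by simp
    qed simp
  next
    case False
    then have "?r D \<noteq> F" if "D \<in> tl_diagrams n" for D using rewire_tl_diagrams[OF that i] by blast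
    then show ?thesis unfolding tl_mult_e_diagram[OF i] by (intro sum.neutral) simp
  qed
qed

section \<open>Existence and uniqueness of the idempotent\<close>

lemma flip_eq_iff: "flip D = F \<longleftrightarrow> D = flip F"
  by (metis flip_flip)

lemma sum_flip: "(\<Sum>D\<in>tl_diagrams n. g (flip D)) = (\<Sum>D\<in>tl_diagrams n. g D)"
  by (rule sum.reindex_bij_witness[of _ flip flip]) (auto simp: flip_tl)

lemma ex_killed_by_caps:
  obtains f where "f \<in> tl_carrier n" "f (id_diagram n) = 1" "killed_by_caps n f"
    "\<And>D. f (flip D) = f D"
proof -
  let ?T = "tl_diagrams n" and ?I = "id_diagram n"
  have "\<exists>f. (\<exists>D\<in>?T. f D \<noteq> 0) \<and>
    (\<forall>E\<in>?T - {?I}. (\<Sum>D\<in>?T. loop_value ^ component_count (points n) E D * f D) = 0)"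
    by (rule nonzero_solution)
      (simp_all only: finite_tl_diagrams finite_Diff card_Diff1_less[OF finite_tl_diagrams id_diagram_tl])
  then obtain h D0 where h: "D0 \<in> ?T" "h D0 \<noteq> 0"
    and "\<And>E. E \<in> ?T - {?I} \<Longrightarrow> (\<Sum>D\<in>?T. loop_value ^ component_count (points n) E D * h D) = 0" by blast
  then have orth: "pairing n h E = 0" if "E \<in> ?T" "E \<noteq> ?I" for E
    unfolding pairing_def using that by (simp add: mult.commute)
  \<comment> \<open>With identity coefficient 0 the solution would agree with the zero
    function.\<close>
  have hI: "h ?I \<noteq> 0"
    using pairing_unique[of n h "\<lambda>_. 0" D0] orth h by (auto simp: pairing_def)
  define f where "f D = (if D \<in> ?T then h D / h ?I else 0)" for D
  have pf: "pairing n f E = 0" if "E \<in> ?T" "E \<noteq> ?I" for E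
  proof -
    have "pairing n f E = pairing n h E / h ?I"
      unfolding pairing_def sum_divide_distrib by (rule sum.cong) (auto simp: f_def)
    then show ?thesis using orth[OF that] by simp
  qed
  have pflip: "pairing n (\<lambda>D. f (flip D)) E = pairing n f (flip E)" for E
  proof -
    have "pairing n (\<lambda>D. f (flip D)) E
      = (\<Sum>D\<in>?T. f (flip D) * loop_value ^ component_count (points n) (flip E) (flip D))"
      unfolding pairing_def component_count_flip ..
    then show ?thesis
      using sum_flip[of "\<lambda>D. f D * loop_value ^ component_count (points n) (flip E) D" n]
      unfolding pairing_def by simp
  qed
  \<comment> \<open>The reflected function is orthogonal to the same diagrams and has the same
    identity coefficient.\<close>
  have "f (flip D) = f D" for D
  proof (cases "D \<in> ?T")
    case True
    show ?thesis
    proof (rule pairing_unique[where f = "\<lambda>D. f (flip D)", OF _ _ True])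
      fix E assume E: "E \<in> ?T" "E \<noteq> ?I"
      then have "flip E \<noteq> ?I" using flip_eq_iff by (metis flip_id_diagram)
      then show "pairing n (\<lambda>D. f (flip D)) E = pairing n f E"
        unfolding pflip using pf E flip_tl by metis
    qed simp
  next
    case False
    then have "flip D \<notin> ?T" using flip_tl by (metis flip_flip)
    then show ?thesis using False by (simp add: f_def)
  qed
  moreover have "f \<in> tl_carrier n" "f ?I = 1"
    using hI id_diagram_tl unfolding tl_carrier_def f_def by auto
  ultimately show ?thesis using that killed_by_capsI[OF pf] by blast
qed

lemma tl_mult_left_flip:
  assumes "E \<in> tl_diagrams n" "\<And>D. f (flip D) = f D"
  shows "tl_mult n (basis (flip E)) f F = tl_mult n f (basis E) (flip F)"
proof -
  have "tl_mult n (basis (flip E)) f F = (\<Sum>D\<in>tl_diagrams n.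
      f (flip D) * loop_value ^ loops n (flip E) (flip D) * basis (stack (flip E) (flip D)) F)"
    unfolding tl_mult_basis_left[OF flip_tl[OF assms(1)]] by (rule sum_flip[symmetric])
  also have "\<dots> = (\<Sum>D\<in>tl_diagrams n. f D * loop_value ^ loops n D E * basis (stack D E) (flip F))"
    unfolding assms(2) loops_flip stack_flip by (simp add: basis_def flip_eq_iff eq_commute[of F])
  finally show ?thesis unfolding tl_mult_basis_right[OF assms(1)] .
qed

definition is_jones_wenzl :: "nat \<Rightarrow> tl \<Rightarrow> bool" where
  "is_jones_wenzl n f \<longleftrightarrow> f \<in> tl_carrier n \<and> f \<noteq> (\<lambda>_. 0) \<and> tl_mult n f f = f \<and>
    (\<forall>i. 1 \<le> i \<and> i \<le> n - 1 \<longrightarrow>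
      tl_mult n (basis (e_diagram n i)) f = (\<lambda>_. 0) \<and>
      tl_mult n f (basis (e_diagram n i)) = (\<lambda>_. 0))"

lemma is_jones_wenzl_killed_by_caps: "is_jones_wenzl n f \<Longrightarrow> killed_by_caps n f"
  unfolding is_jones_wenzl_def killed_by_caps_def by auto

lemma ex1_jones_wenzl: "\<exists>!f. is_jones_wenzl n f"
proof (rule ex_ex1I)
  obtain f where f: "f \<in> tl_carrier n" "f (id_diagram n) = 1" "killed_by_caps n f"
    "\<And>D. f (flip D) = f D" using ex_killed_by_caps by metis
  have "tl_mult n (basis (e_diagram n i)) f = (\<lambda>_. 0)" if "1 \<le> i" "i < n" for i
  proof
    fix F
    show "tl_mult n (basis (e_diagram n i)) f F = 0"
      using tl_mult_left_flip[where f = f, OF e_diagram_tl[OF that] f(4), of F] f(3) that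
      unfolding killed_by_caps_def by simp
  qed
  moreover have "f \<noteq> (\<lambda>_. 0)" using f(2) by auto
  moreover have "tl_mult n f f = f" using tl_mult_killed_by_caps[OF f(3,1)] f(2) by simp
  moreover have "i < n" if "1 \<le> i \<and> i \<le> n - 1" for i using that by auto
  ultimately have "is_jones_wenzl n f"
    using f(1,3) unfolding is_jones_wenzl_def killed_by_caps_def by blast
  then show "\<exists>f. is_jones_wenzl n f" by (rule exI[of _ f])
next
  fix f g assume fg: "is_jones_wenzl n f" "is_jones_wenzl n g"
  have id1: "h (id_diagram n) = 1" if h: "is_jones_wenzl n h" for h
  proof -
    have "\<exists>F. h F \<noteq> 0" using h unfolding is_jones_wenzl_def by auto
    then obtain F where F: "h F \<noteq> 0" ..
    have "h F = h (id_diagram n) * h F"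
      using tl_mult_killed_by_caps[OF is_jones_wenzl_killed_by_caps[OF h], of h] h
      unfolding is_jones_wenzl_def by metis
    then show ?thesis using F by simp
  qed
  show "f = g"
  proof
    fix D
    show "f D = g D"
    proof (cases "D \<in> tl_diagrams n")
      case True
      show ?thesis
        by (rule pairing_unique[OF _ _ True])
          (use id1[OF fg(1)] id1[OF fg(2)] pairing_eq_0[OF is_jones_wenzl_killed_by_caps[OF fg(1)]]
            pairing_eq_0[OF is_jones_wenzl_killed_by_caps[OF fg(2)]] in auto)
    next
      case False
      then show ?thesis using fg unfolding is_jones_wenzl_def tl_carrier_def by simp
    qed
  qed
qed

lemma jones_wenzl_killed_by_caps: "killed_by_caps n (jones_wenzl n)"
proof -
  have "is_jones_wenzl n (THE f. is_jones_wenzl n f)" by (rule theI'[OF ex1_jones_wenzl])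
  then show ?thesis
    using is_jones_wenzl_killed_by_caps unfolding jones_wenzl_def is_jones_wenzl_def[abs_def] by blast
qed

section \<open>Moves\<close>

text \<open>Unlike in \<open>nested_caps\<close>, the outermost arc and the number of arcs are
  independent, so that nests surrounding other arcs are included.\<close>

definition caps :: "nat \<Rightarrow> nat \<Rightarrow> nat \<Rightarrow> nat set set" where
  "caps a b m = (\<lambda>t. {a + t, b - t}) ` {..<m}"

lemma caps_0 [simp]: "caps a b 0 = {}"
  by (simp add: caps_def)

lemma caps_Suc: "caps a b (Suc m) = insert {a, b} (caps (Suc a) (b - 1) m)"
  unfolding caps_def lessThan_Suc_eq_insert_0 by (simp add: image_image)

lemma caps_Suc_inner: "caps a b (Suc m) = insert {a + m, b - m} (caps a b m)"
  unfolding caps_def lessThan_Suc by simp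

lemma nested_caps_eq: "nested_caps a k = caps a (a + 2 * k - 1) k"
  unfolding nested_caps_def caps_def by blast

text \<open>Half-open intervals let adjacent blocks meet at a common bound and admit the empty
  block, from which nests are built by wrapping.\<close>

definition noncrossing_block :: "nat \<Rightarrow> nat \<Rightarrow> nat set set \<Rightarrow> bool" where
  "noncrossing_block l u M \<longleftrightarrow> perfect_matching {l..<u} M \<and> noncrossing M"

lemma perfect_matching_Un:
  assumes "perfect_matching A M" "perfect_matching B N" "A \<inter> B = {}"
  shows "perfect_matching (A \<union> B) (M \<union> N)"
proof (rule perfect_matchingI)
  show "c \<subseteq> A \<union> B \<and> card c = 2" if "c \<in> M \<union> N" for c
    using that perfect_matching_subset[OF assms(1), of c] perfect_matching_subset[OF assms(2), of c]
      assms(1,2) unfolding perfect_matching_def by blast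
  show "\<exists>c\<in>M \<union> N. x \<in> c" if "x \<in> A \<union> B" for x
    using that assms(1,2) unfolding perfect_matching_def partition_on_def by blast
  show "c = d" if cd: "c \<in> M \<union> N" "d \<in> M \<union> N" and x: "x \<in> c" "x \<in> d" for c d x
  proof -
    have "c \<in> M \<Longrightarrow> x \<in> A" "d \<in> M \<Longrightarrow> x \<in> A" "c \<in> N \<Longrightarrow> x \<in> B" "d \<in> N \<Longrightarrow> x \<in> B"
      using x perfect_matching_subset[OF assms(1)] perfect_matching_subset[OF assms(2)] by blast+
    then show ?thesis
      using cd x assms(3) perfect_matching_unique[OF assms(1), of c d x]
        perfect_matching_unique[OF assms(2), of c d x] by blast
  qed
qed

lemma perfect_matching_Diff:
  assumes "perfect_matching A M" "perfect_matching B N" "N \<subseteq> M"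
  shows "perfect_matching (A - B) (M - N)"
proof (rule perfect_matchingI)
  have B: "x \<in> B \<longleftrightarrow> (\<exists>c\<in>N. x \<in> c)" for x
    using assms(2) unfolding perfect_matching_def partition_on_def by blast
  have disj: "x \<notin> c" if "c \<in> M - N" "x \<in> B" for c x
    using that B perfect_matching_unique[OF assms(1)] assms(3) by blast
  show "c \<subseteq> A - B \<and> card c = 2" if c: "c \<in> M - N" for c
    using disj[OF c] c perfect_matching_subset[OF assms(1), of c] assms(1)
    unfolding perfect_matching_def by blast
  show "\<exists>c\<in>M - N. x \<in> c" if "x \<in> A - B" for x
    using that B assms(1) unfolding perfect_matching_def partition_on_def by blast
  show "c = d" if "c \<in> M - N" "d \<in> M - N" "x \<in> c" "x \<in> d" for c d x
    using that perfect_matching_unique[OF assms(1)] by blast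
qed

text \<open>The block fills an interval free of points of \<open>M\<close>, so no arc of
  \<open>M\<close> has an end between the two ends of an arc of \<open>N\<close>.\<close>

lemma noncrossing_Un_block:
  assumes "perfect_matching A M" "noncrossing M" "noncrossing_block l u N" "A \<inter> {l..<u} = {}"
  shows "noncrossing (M \<union> N)"
  unfolding noncrossing_def
proof (intro notI, elim exE conjE)
  fix a b c d assume o: "a < b" "b < c" "c < d" and ac: "{a, c} \<in> M \<union> N" and bd: "{b, d} \<in> M \<union> N"
  have N: "perfect_matching {l..<u} N" "noncrossing N" using assms(3) unfolding noncrossing_block_def by auto
  have out: "x \<notin> {l..<u} \<and> y \<notin> {l..<u}" if "{x, y} \<in> M" for x y
    using perfect_matching_subset[OF assms(1) that] assms(4) by blast
  have inn: "x \<in> {l..<u} \<and> y \<in> {l..<u}" if "{x, y} \<in> N" for x y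
    using perfect_matching_subset[OF N(1) that] by blast
  consider "{a, c} \<in> M" "{b, d} \<in> M" | "{a, c} \<in> M" "{b, d} \<in> N"
    | "{a, c} \<in> N" "{b, d} \<in> M" | "{a, c} \<in> N" "{b, d} \<in> N" using ac bd by blast
  then show False
  proof cases
    case 1
    then show ?thesis using assms(2) o unfolding noncrossing_def by blast
  next
    case 2
    then show ?thesis using out[of a c] inn[of b d] o by simp
  next
    case 3
    then show ?thesis using inn[of a c] out[of b d] o by simp
  next
    case 4
    then show ?thesis using N(2) o unfolding noncrossing_def by blast
  qed
qed

lemma noncrossing_single: "noncrossing {{a, b}}"
  unfolding noncrossing_def by (auto simp: doubleton_eq_iff)

lemma noncrossing_block_empty: "noncrossing_block l l {}"
  unfolding noncrossing_block_def noncrossing_def by (simp add: perfect_matching_def partition_on_def)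

lemma perfect_matching_single: "a \<noteq> b \<Longrightarrow> perfect_matching {a, b} {{a, b}}"
  by (rule perfect_matchingI) auto

lemma noncrossing_block_wrap:
  assumes "noncrossing_block (Suc l) u M" "l < u"
  shows "noncrossing_block l (Suc u) (insert {l, u} M)"
proof -
  have pm: "perfect_matching {l, u} {{l, u}}" using assms(2) by (intro perfect_matching_single) simp
  have "noncrossing ({{l, u}} \<union> M)"
    by (rule noncrossing_Un_block[OF pm noncrossing_single assms(1)]) auto
  moreover have "perfect_matching ({l, u} \<union> {Suc l..<u}) ({{l, u}} \<union> M)"
    by (rule perfect_matching_Un[OF pm]) (use assms(1) in \<open>auto simp: noncrossing_block_def\<close>)
  moreover have "{l, u} \<union> {Suc l..<u} = {l..<Suc u}" using assms(2) by auto
  ultimately show ?thesis unfolding noncrossing_block_def by simp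
qed

lemma noncrossing_block_Un:
  assumes "noncrossing_block l m M" "noncrossing_block m u N" "l \<le> m" "m \<le> u"
  shows "noncrossing_block l u (M \<union> N)"
proof -
  have M: "perfect_matching {l..<m} M" "noncrossing M" and N: "perfect_matching {m..<u} N"
    using assms(1,2) unfolding noncrossing_block_def by auto
  have dis: "{l..<m} \<inter> {m..<u} = {}" by auto
  have "{l..<m} \<union> {m..<u} = {l..<u}" using assms(3,4) by auto
  then show ?thesis
    using noncrossing_Un_block[OF M assms(2) dis] perfect_matching_Un[OF M(1) N dis]
    unfolding noncrossing_block_def by simp
qed

lemma noncrossing_block_caps:
  "b + 1 = a + 2 * m \<Longrightarrow> noncrossing_block a (b + 1) (caps a b m)"
proof (induction m arbitrary: a b)
  case 0
  then show ?case using noncrossing_block_empty[of a] by simp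
next
  case (Suc m)
  have "noncrossing_block (Suc a) (b - 1 + 1) (caps (Suc a) (b - 1) m)"
    by (rule Suc.IH) (use Suc.prems in simp)
  then have "noncrossing_block (Suc a) b (caps (Suc a) (b - 1) m)" using Suc.prems by simp
  then show ?case using noncrossing_block_wrap[of a b] Suc.prems unfolding caps_Suc by simp
qed

text \<open>The intermediate stages of a move: a cap followed by \<open>m\<close> nested caps, all of it
  below \<open>j\<close> nested caps, occupying the points from \<open>a\<close> to \<open>b = a + 2 (j + m) + 1\<close>.\<close>

definition stage :: "nat \<Rightarrow> nat \<Rightarrow> nat \<Rightarrow> nat \<Rightarrow> nat set set" where
  "stage a b j m = caps a b j \<union> insert {a + j, a + j + 1} (caps (a + j + 2) (b - j) m)"

lemma noncrossing_block_stage: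
  "b = a + 2 * (j + m) + 1 \<Longrightarrow> noncrossing_block a (b + 1) (stage a b j m)"
proof (induction j arbitrary: a b)
  case 0
  have "noncrossing_block a (a + 2) {{a, a + 1}}"
    using noncrossing_block_caps[of "a + 1" a 1] by (simp add: caps_Suc)
  moreover have "noncrossing_block (a + 2) (b + 1) (caps (a + 2) b m)"
    by (rule noncrossing_block_caps) (use 0 in simp)
  ultimately have "noncrossing_block a (b + 1) ({{a, a + 1}} \<union> caps (a + 2) b m)"
    by (rule noncrossing_block_Un) (use 0 in auto)
  then show ?case by (simp add: stage_def)
next
  case (Suc j)
  have "noncrossing_block (Suc a) (b - 1 + 1) (stage (Suc a) (b - 1) j m)"
    by (rule Suc.IH) (use Suc.prems in simp)
  then have "noncrossing_block (Suc a) b (stage (Suc a) (b - 1) j m)" using Suc.prems by simp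
  then have "noncrossing_block a (Suc b) (insert {a, b} (stage (Suc a) (b - 1) j m))"
    by (rule noncrossing_block_wrap) (use Suc.prems in simp)
  moreover have "insert {a, b} (stage (Suc a) (b - 1) j m) = stage a b (Suc j) m"
    unfolding stage_def caps_Suc by (simp add: diff_diff_left insert_commute[of "{a, b}"])
  ultimately show ?case by simp
qed

section \<open>Undoing a contraction\<close>

lemma rewire_preimage:
  assumes M: "perfect_matching A M" "noncrossing M" and A: "p \<in> A" "Suc p \<in> A"
    and no_cap: "{p, Suc p} \<notin> M" and l: "p = Suc l"
    and N: "rewire p (Suc p) M = N" and out: "{l, v} \<in> N"
    and sib: "v = p + 2 \<and> s = Suc p \<or> v = Suc s \<and> p + 2 < s \<and> {p + 2, s} \<in> N"
  shows "M = insert {p, l} (insert {Suc p, v} (N - {{p, Suc p}, {l, v}})) \<or>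
    p + 2 < s \<and> M = insert {p, s} (insert {Suc p, p + 2} (N - {{p, Suc p}, {s, p + 2}}))"
proof -
  obtain x y M0 where xy: "x \<noteq> y" "x \<notin> {p, Suc p}" "y \<notin> {p, Suc p}"
    and M': "M = insert {p, x} (insert {Suc p, y} M0)"
    and M0: "\<forall>c\<in>M0. c \<inter> {p, Suc p, x, y} = {}"
    and N': "rewire p (Suc p) M = insert {p, Suc p} (insert {x, y} M0)"
    using perfect_matching_two_arcs[OF M(1) A n_not_Suc_n no_cap] by metis
  have "{p, Suc p} \<notin> M0" "{x, y} \<notin> M0"
    using bspec[OF M0, of "{p, Suc p}"] bspec[OF M0, of "{x, y}"] by auto
  moreover have "insert c (insert d S) - {c, d} = S" if "c \<notin> S" "d \<notin> S" for c d :: "nat set" and S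
    using that by auto
  ultimately have M0': "M0 = N - {{p, Suc p}, {x, y}}" unfolding N[symmetric] N' by metis
  have arcs: "{p, x} \<in> M" "{Suc p, y} \<in> M" using M' by auto
  have cross: "\<not> (a < b \<and> b < c \<and> c < d \<and> {a, c} \<in> M \<and> {b, d} \<in> M)" for a b c d
    using M(2) unfolding noncrossing_def by blast
  have inM: "c \<in> M" "c \<inter> {p, Suc p, x, y} = {}" if "c \<in> N" "c \<noteq> {p, Suc p}" "c \<noteq> {x, y}" for c
  proof -
    have c: "c \<in> M0" using that M0' by simp
    then show "c \<in> M" using M' by simp
    show "c \<inter> {p, Suc p, x, y} = {}" using bspec[OF M0 c] .
  qed
  have nt: "{l, v} \<noteq> {p, Suc p}" using l by (auto simp: doubleton_eq_iff)
  have vp: "p + 2 \<le> v" using sib by auto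
  \<comment> \<open>A preimage is determined by the arc \<open>{x, y}\<close> of \<open>N\<close>
    that the rewiring created and by the way its ends are attached to \<open>p\<close> and
    \<open>Suc p\<close>.\<close>
  consider "{l, v} = {x, y}" | "p + 2 < s" "{p + 2, s} = {x, y}"
    | "{l, v} \<noteq> {x, y}" "p + 2 < s \<longrightarrow> {p + 2, s} \<noteq> {x, y}" by blast
  then show ?thesis
  proof cases
    case 1
    then consider "x = l" "y = v" | "x = v" "y = l" by (auto simp: doubleton_eq_iff)
    then show ?thesis
    proof cases
      case 1
      then show ?thesis using M'[unfolded M0'] by (intro disjI1) (simp only:)
    next
      \<comment> \<open>Attaching the ends the other way round makes the two arcs cross.\<close>
      case 2
      then have "{l, Suc p} \<in> M" "{p, v} \<in> M" using arcs by (auto simp: insert_commute)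
      then show ?thesis using cross[of l p "Suc p" v] l vp by simp
    qed
  next
    case 2
    note ps = 2(1)
    from 2 consider "x = s" "y = p + 2" | "x = p + 2" "y = s" by (auto simp: doubleton_eq_iff)
    then show ?thesis
    proof cases
      case 1
      then show ?thesis using M'[unfolded M0'] ps by (intro disjI2) (simp only:)
    next
      case 2
      then have "{p, p + 2} \<in> M" "{Suc p, s} \<in> M" using arcs by auto
      then show ?thesis using cross[of p "Suc p" "p + 2" s] ps by simp
    qed
  next
    case 3
    \<comment> \<open>The arc \<open>{p, x}\<close> crosses neither \<open>{l, v}\<close> nor
      \<open>{p + 2, s}\<close>, so \<open>x\<close> lies under the first but not under the second.
      Strictly between \<open>l\<close> and \<open>v\<close> there are only \<open>p\<close>,
      \<open>p + 1\<close> and the points from \<open>p + 2\<close> to \<open>s\<close>, which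
      leaves no place for \<open>x\<close>.\<close>
    have lv: "{l, v} \<in> M" "{l, v} \<inter> {p, Suc p, x, y} = {}" using inM[OF out nt] 3(1) by auto
    have "l < p \<and> p < v \<longleftrightarrow> l < x \<and> x < v"
      by (rule noncrossingD[OF M(2) arcs(1) lv(1)]) (use lv(2) in auto)
    then have x: "l < x" "x < v" using l vp by auto
    show ?thesis
    proof (cases "p + 2 < s")
      case True
      then have s: "v = Suc s" "{p + 2, s} \<in> N" using sib by auto
      have "{p + 2, s} \<noteq> {p, Suc p}" using True by (auto simp: doubleton_eq_iff)
      then have ps: "{p + 2, s} \<in> M" "{p + 2, s} \<inter> {p, Suc p, x, y} = {}"
        using inM[OF s(2)] 3(2) True by auto
      have "p + 2 < p \<and> p < s \<longleftrightarrow> p + 2 < x \<and> x < s"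
        by (rule noncrossingD[OF M(2) arcs(1) ps(1)]) (use ps(2) True in auto)
      then have "\<not> (p + 2 < x \<and> x < s)" by simp
      moreover have "x \<noteq> p + 2" "x \<noteq> s" using ps(2) by auto
      moreover have "x \<noteq> p" "x \<noteq> Suc p" using xy by auto
      ultimately show ?thesis using x s(1) l by linarith
    next
      case False
      then have "v = p + 2" using sib by auto
      then show ?thesis using x l xy by auto
    qed
  qed
qed

text \<open>The coefficient of \<open>F\<close> in \<open>f e_i = 0\<close> collects the diagrams
  that rewire to \<open>F\<close>: \<open>F\<close> itself with weight \<open>- qint 2\<close>, and
  the preimages without the cap, with weight 1.\<close>

lemma contraction_sum:
  assumes f: "killed_by_caps n f" and i: "1 \<le> i" "i < n"
    and F: "F \<in> tl_diagrams n" "{i, i + 1} \<in> capform n F"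
    and X: "X \<subseteq> tl_diagrams n" "F \<notin> X"
      "\<And>D. D \<in> tl_diagrams n \<Longrightarrow> {i, i + 1} \<notin> capform n D \<Longrightarrow>
        rewire i (i + 1) (capform n D) = capform n F \<longleftrightarrow> D \<in> X"
      "\<And>D. D \<in> X \<Longrightarrow> {i, i + 1} \<notin> capform n D"
  shows "qint 2 * f F = (\<Sum>D\<in>X. f D)"
proof -
  let ?r = "rewire (Lower i) (Lower (i + 1))"
  have cap: "{Lower i, Lower (i + 1)} \<in> D \<longleftrightarrow> {i, i + 1} \<in> capform n D" if D: "D \<in> tl_diagrams n" for D
  proof
    assume "{Lower i, Lower (i + 1)} \<in> D"
    from imageI[OF this, of "(`) (fold_pt n)"] show "{i, i + 1} \<in> capform n D"
      unfolding capform_def by simp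
  next
    assume c: "{i, i + 1} \<in> capform n D"
    have "capform n (?r D) = capform n D"
      using capform_rewire[OF D i] rewire_arc[OF tl_diagramsD(3)[OF D] c] by simp
    then have "?r D = D" using inj_onD[OF inj_on_capform] D rewire_tl_diagrams[OF D i] by metis
    then show "{Lower i, Lower (i + 1)} \<in> D" using arc_in_rewire by metis
  qed
  have rw: "?r D = F \<longleftrightarrow> D \<in> insert F X" if D: "D \<in> tl_diagrams n" for D
  proof -
    have "?r D = F \<longleftrightarrow> rewire i (i + 1) (capform n D) = capform n F"
      using capform_rewire[OF D i] inj_on_eq_iff[OF inj_on_capform rewire_tl_diagrams[OF D i] F(1)] by metis
    also have "\<dots> \<longleftrightarrow> D \<in> insert F X"
    proof (cases "{i, i + 1} \<in> capform n D")
      case True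
      then show ?thesis
        using rewire_arc[OF tl_diagramsD(3)[OF D] True] X(4)[of D] inj_on_eq_iff[OF inj_on_capform D F(1)]
        by auto
    next
      case False
      then show ?thesis using X(3)[OF D False] F by auto
    qed
    finally show ?thesis .
  qed
  have "0 = tl_mult n f (basis (e_diagram n i)) F" using f i unfolding killed_by_caps_def by simp
  also have "\<dots> = (\<Sum>D\<in>insert F X. f D * loop_value ^ has_lower_cap i D)"
    unfolding tl_mult_e_diagram[OF i]
  proof (rule sum.mono_neutral_cong_right)
    show "insert F X \<subseteq> tl_diagrams n" using F X by blast
    show "\<forall>D\<in>tl_diagrams n - insert F X. f D * loop_value ^ has_lower_cap i D * basis (?r D) F = 0"
      using rw by auto
    show "f D * loop_value ^ has_lower_cap i D * basis (?r D) F = f D * loop_value ^ has_lower_cap i D"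
      if "D \<in> insert F X" for D
      using rw[of D] that F X by auto
  qed (rule finite_tl_diagrams)
  also have "\<dots> = f F * loop_value ^ has_lower_cap i F + (\<Sum>D\<in>X. f D * loop_value ^ has_lower_cap i D)"
    by (rule sum.insert) (use X finite_subset[OF X(1) finite_tl_diagrams] in auto)
  also have "(\<Sum>D\<in>X. f D * loop_value ^ has_lower_cap i D) = (\<Sum>D\<in>X. f D)"
    by (rule sum.cong) (use X cap in auto)
  finally show ?thesis using cap[OF F(1)] F(2) by (simp add: algebra_simps)
qed

text \<open>Two perfect matchings containing \<open>Y\<close> keep it away from the four points: an
  arc of \<open>Y\<close> through one of them would be one of the two displayed arcs in each
  matching, and these pairs have no arc in common.\<close>

lemma exchange_arcs:
  assumes N: "perfect_matching A (insert {p, r} (insert {x, y} Y))"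
    and G: "perfect_matching A (insert {p, x} (insert {r, y} Y))"
    and ne: "x \<notin> {p, r}" "y \<notin> {p, r}" "p \<noteq> r"
  shows "insert {p, r} (insert {x, y} Y) - {{p, r}, {x, y}} = Y"
    and "rewire p r (insert {p, x} (insert {r, y} Y)) = insert {p, r} (insert {x, y} Y)"
    and "{p, r} \<notin> insert {p, x} (insert {r, y} Y)"
proof -
  have avoid: "c \<inter> {p, r, x, y} = {}" if c: "c \<in> Y" for c
  proof (rule ccontr)
    assume "c \<inter> {p, r, x, y} \<noteq> {}"
    then obtain z where z: "z \<in> c" "z \<in> {p, r, x, y}" by blast
    then have "c = {p, r} \<or> c = {x, y}"
      using perfect_matching_unique[OF N, of c "{p, r}" z] perfect_matching_unique[OF N, of c "{x, y}" z] c
      by auto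
    moreover have "c = {p, x} \<or> c = {r, y}"
      using perfect_matching_unique[OF G, of c "{p, x}" z] perfect_matching_unique[OF G, of c "{r, y}" z] c z
      by auto
    moreover have "{p, r} \<noteq> {p, x}" "{p, r} \<noteq> {r, y}" "{x, y} \<noteq> {p, x}" "{x, y} \<noteq> {r, y}"
      using ne by (simp_all add: doubleton_eq_iff) auto
    ultimately show False by metis
  qed
  have "{p, r} \<notin> Y" "{x, y} \<notin> Y" using avoid[of "{p, r}"] avoid[of "{x, y}"] by auto
  then show "insert {p, r} (insert {x, y} Y) - {{p, r}, {x, y}} = Y" by auto
  show "rewire p r (insert {p, x} (insert {r, y} Y)) = insert {p, r} (insert {x, y} Y)"
    by (rule rewire_two_arcs) (use avoid ne in auto)
  show "{p, r} \<notin> insert {p, x} (insert {r, y} Y)"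
    using \<open>{p, r} \<notin> Y\<close> ne by (auto simp: doubleton_eq_iff)
qed

text \<open>The arc \<open>{l, v}\<close> lies directly over the cap \<open>{p, p + 1}\<close>, and the region below it contains besides
  the cap at most one outermost arc, \<open>{p + 2, s}\<close>. By planarity only these two arcs can
  be exchanged with the cap; \<open>s = p + 1\<close> encodes that the second one is absent.\<close>

lemma contraction_step:
  assumes f: "killed_by_caps n f" and p: "p = Suc l" "p < n"
    and T: "F \<in> tl_diagrams n" "G \<in> tl_diagrams n"
    and F: "capform n F = insert {p, Suc p} (insert {l, v} Y)"
    and G: "capform n G = insert {p, l} (insert {Suc p, v} Y)"
    and sib: "v = p + 2 \<and> s = Suc p \<or> v = Suc s \<and> p + 2 < s"
    and H: "p + 2 < s \<Longrightarrow> H \<in> tl_diagrams n \<and>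
      capform n F = insert {p, Suc p} (insert {s, p + 2} Z) \<and>
      capform n H = insert {p, s} (insert {Suc p, p + 2} Z)"
  shows "qint 2 * f F = f G + (if p + 2 < s then f H else 0)"
proof -
  let ?X = "insert G (if p + 2 < s then {H} else {})"
  note pm = tl_diagramsD(3)
  have lv: "l \<notin> {p, Suc p}" "v \<notin> {p, Suc p}" "p \<noteq> Suc p" using p sib by auto
  have A: "p \<in> {1..2 * n}" "Suc p \<in> {1..2 * n}" using p by auto
  note exG = exchange_arcs[OF pm[OF T(1), unfolded F] pm[OF T(2), unfolded G] lv]
  have Gprops: "capform n F - {{p, Suc p}, {l, v}} = Y" "rewire p (Suc p) (capform n G) = capform n F"
    "{p, Suc p} \<notin> capform n G" using exG unfolding F G by auto
  have Hprops: "capform n F - {{p, Suc p}, {s, p + 2}} = Z" "rewire p (Suc p) (capform n H) = capform n F"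
    "{p, Suc p} \<notin> capform n H" "H \<noteq> G" if s: "p + 2 < s"
  proof -
    note HT = H[OF s]
    have F': "capform n F = insert {p, Suc p} (insert {s, p + 2} Z)"
      and H': "capform n H = insert {p, s} (insert {Suc p, p + 2} Z)" using HT by auto
    have sp: "s \<notin> {p, Suc p}" "p + 2 \<notin> {p, Suc p}" using s by auto
    have pmF: "perfect_matching {1..2 * n} (insert {p, Suc p} (insert {s, p + 2} Z))"
      using pm[OF T(1)] F' by simp
    have pmH: "perfect_matching {1..2 * n} (insert {p, s} (insert {Suc p, p + 2} Z))"
      using pm[of H n] HT H' by simp
    note exH = exchange_arcs[OF pmF pmH sp lv(3)]
    show "capform n F - {{p, Suc p}, {s, p + 2}} = Z" using exH(1) unfolding F' .
    show "rewire p (Suc p) (capform n H) = capform n F" using exH(2) unfolding H' F' .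
    show "{p, Suc p} \<notin> capform n H" using exH(3) unfolding H' .
    \<comment> \<open>Distinctness gives the sum over \<open>?X\<close> two separate terms.\<close>
    show "H \<noteq> G"
    proof
      assume "H = G"
      moreover have "{p, s} \<in> capform n H" unfolding H' by simp
      moreover have "{p, l} \<in> capform n G" unfolding G by simp
      ultimately have "{p, s} \<in> capform n G" "{p, l} \<in> capform n G" by simp_all
      then have "s = l" using perfect_matching_mate_eq[OF pm[OF T(2)]] by metis
      then show False using s p by simp
    qed
  qed
  have "qint 2 * f F = (\<Sum>D\<in>?X. f D)"
  proof (rule contraction_sum[OF f, of p])
    show "1 \<le> p" "p < n" using p by auto
    show "F \<in> tl_diagrams n" by (rule T(1))
    show "{p, p + 1} \<in> capform n F" using F by simp
    show "?X \<subseteq> tl_diagrams n" using T H by auto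
    show no_cap: "{p, p + 1} \<notin> capform n D" if "D \<in> ?X" for D
      using that Gprops(3) Hprops(3) by (auto split: if_splits)
    have "{p, p + 1} \<in> capform n F" using F by simp
    then show "F \<notin> ?X" using no_cap by blast
    fix D assume D: "D \<in> tl_diagrams n" and cap: "{p, p + 1} \<notin> capform n D"
    show "rewire p (p + 1) (capform n D) = capform n F \<longleftrightarrow> D \<in> ?X"
    proof
      assume "D \<in> ?X"
      then show "rewire p (p + 1) (capform n D) = capform n F"
        using Gprops(2) Hprops(2) by (auto split: if_splits)
    next
      assume rw: "rewire p (p + 1) (capform n D) = capform n F"
      have sib': "v = p + 2 \<and> s = Suc p \<or> v = Suc s \<and> p + 2 < s \<and> {p + 2, s} \<in> capform n F"
        using sib H by (auto simp: insert_commute)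
      have "capform n D = insert {p, l} (insert {Suc p, v} (capform n F - {{p, Suc p}, {l, v}})) \<or>
        p + 2 < s \<and> capform n D = insert {p, s} (insert {Suc p, p + 2} (capform n F - {{p, Suc p}, {s, p + 2}}))"
        by (rule rewire_preimage[OF pm[OF D] tl_diagramsD(2)[OF D] A _ p(1) _ _ sib'])
          (use cap rw F in simp_all)
      then show "D \<in> ?X"
      proof (elim disjE conjE)
        assume "capform n D = insert {p, l} (insert {Suc p, v} (capform n F - {{p, Suc p}, {l, v}}))"
        then have "capform n D = capform n G" unfolding Gprops(1) G .
        then have "D = G" by (rule inj_onD[OF inj_on_capform _ D T(2)])
        then show ?thesis by simp
      next
        assume less: "p + 2 < s"
          and "capform n D = insert {p, s} (insert {Suc p, p + 2} (capform n F - {{p, Suc p}, {s, p + 2}}))"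
        then have "capform n D = capform n H" using H unfolding Hprops(1)[OF less] by simp
        then have "D = H" by (rule inj_onD[OF inj_on_capform _ D]) (use H less in simp)
        then show ?thesis using less by simp
      qed
    qed
  qed
  also have "\<dots> = f G + (if p + 2 < s then f H else 0)" using Hprops(4) by auto
  finally show ?thesis .
qed

text \<open>Two neighbouring stages are compared from both sides: here the cap of the stage with
  more outer arcs is exchanged with the arc over it, in the next lemma the cap of the other stage
  with the outermost arc to its right.\<close>

lemma stage_exchange_outer:
  "stage a b (Suc j) m = insert {a + Suc j, Suc (a + Suc j)} (insert {a + j, b - j}
    (caps a b j \<union> caps (a + Suc j + 2) (b - Suc j) m))"
  "stage a b j (Suc m) = insert {a + Suc j, a + j} (insert {Suc (a + Suc j), b - j}
    (caps a b j \<union> caps (a + Suc j + 2) (b - Suc j) m))"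
proof -
  show "stage a b (Suc j) m = insert {a + Suc j, Suc (a + Suc j)} (insert {a + j, b - j}
    (caps a b j \<union> caps (a + Suc j + 2) (b - Suc j) m))"
    unfolding stage_def caps_Suc_inner by simp
  have "caps (a + j + 2) (b - j) (Suc m) = insert {Suc (a + Suc j), b - j} (caps (a + Suc j + 2) (b - Suc j) m)"
    unfolding caps_Suc by simp
  then show "stage a b j (Suc m) = insert {a + Suc j, a + j} (insert {Suc (a + Suc j), b - j}
    (caps a b j \<union> caps (a + Suc j + 2) (b - Suc j) m))"
    unfolding stage_def by (simp add: insert_commute)
qed

lemma stage_exchange_right:
  "stage a b j (Suc m) = insert {a + j, Suc (a + j)} (insert {b - j, a + j + 2}
    (caps a b j \<union> caps (a + j + 3) (b - Suc j) m))"
  "stage a b (Suc j) m = insert {a + j, b - j} (insert {Suc (a + j), a + j + 2}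
    (caps a b j \<union> caps (a + j + 3) (b - Suc j) m))"
proof -
  have "caps (a + j + 2) (b - j) (Suc m) = insert {b - j, a + j + 2} (caps (a + j + 3) (b - Suc j) m)"
    unfolding caps_Suc by (simp add: insert_commute numeral_3_eq_3)
  then show "stage a b j (Suc m) = insert {a + j, Suc (a + j)} (insert {b - j, a + j + 2}
    (caps a b j \<union> caps (a + j + 3) (b - Suc j) m))"
    unfolding stage_def by simp
  show "stage a b (Suc j) m = insert {a + j, b - j} (insert {Suc (a + j), a + j + 2}
    (caps a b j \<union> caps (a + j + 3) (b - Suc j) m))"
    unfolding stage_def caps_Suc_inner by (simp add: insert_commute numeral_3_eq_3)
qed

theorem proposition6p1:
  fixes n k :: nat and D D' :: diagram
  assumes "n \<ge> 1" and "k \<ge> 1"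
    and "D \<in> tl_diagrams n" and "D' \<in> tl_diagrams n"
    and "k_move n k D D'"
  shows "qint k * jones_wenzl n D = jones_wenzl n D'"
proof -
  let ?f = "jones_wenzl n"
  obtain K where k: "k = Suc K" using assms(2) by (cases k) auto
  obtain a where a: "1 \<le> a" "a + k \<le> n" and sub: "nested_caps a k \<subseteq> capform n D"
    and D': "capform n D' = (capform n D - nested_caps a k) \<union> ({{a, a + 1}} \<union> nested_caps (a + 2) (k - 1))"
    using assms(5) unfolding k_move_def by blast
  \<comment> \<open>The last point of the nest of \<open>K + 1\<close> arcs.\<close>
  define b where "b = a + 2 * K + 1"
  have nested: "nested_caps a k = stage a b K 0" "{{a, a + 1}} \<union> nested_caps (a + 2) (k - 1) = stage a b 0 K"
    unfolding nested_caps_eq stage_def k b_def by (simp_all add: caps_Suc_inner add.commute[of K])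
  define R where "R = capform n D - nested_caps a k"
  have pmD: "perfect_matching {1..2 * n} (capform n D)" and ncD: "noncrossing (capform n D)"
    using tl_diagramsD[OF assms(3)] by auto
  have pmN: "perfect_matching {a..<b + 1} (nested_caps a k)"
    using noncrossing_block_stage[of b a K 0] unfolding nested noncrossing_block_def by (simp add: b_def)
  have pmR: "perfect_matching ({1..2 * n} - {a..<b + 1}) R"
    unfolding R_def by (rule perfect_matching_Diff[OF pmD pmN sub])
  have ncR: "noncrossing R" using ncD unfolding R_def noncrossing_def by blast
  have pts: "({1..2 * n} - {a..<b + 1}) \<union> {a..<b + 1} = {1..2 * n}"
    using a unfolding b_def k by auto
  have "\<exists>E. E \<in> tl_diagrams n \<and> capform n E = R \<union> stage a b j (K - j)" if "j \<le> K" for j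
  proof -
    have block: "noncrossing_block a (b + 1) (stage a b j (K - j))"
      by (rule noncrossing_block_stage) (use that in \<open>simp add: b_def\<close>)
    have "noncrossing (R \<union> stage a b j (K - j))"
      by (rule noncrossing_Un_block[OF pmR ncR block]) auto
    moreover have "perfect_matching {1..2 * n} (R \<union> stage a b j (K - j))"
      using perfect_matching_Un[OF pmR, of "{a..<b + 1}" "stage a b j (K - j)"] block
      unfolding pts noncrossing_block_def by blast
    ultimately show ?thesis using capform_surj by metis
  qed
  then obtain E where E: "\<And>j. j \<le> K \<Longrightarrow> E j \<in> tl_diagrams n"
    "\<And>j. j \<le> K \<Longrightarrow> capform n (E j) = R \<union> stage a b j (K - j)" by metis
  have "capform n (E K) = capform n D" using E(2)[of K] sub unfolding R_def nested by auto
  then have EK: "E K = D" using inj_onD[OF inj_on_capform] E(1) assms(3) by blast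
  have "capform n (E 0) = capform n D'" using E(2)[of 0] unfolding D' R_def nested by simp
  then have E0: "E 0 = D'" using inj_onD[OF inj_on_capform] E(1) assms(4) by blast
  have step: "qint 2 * ?f (E (Suc j)) = ?f (E j) + (if Suc j < K then ?f (E (Suc (Suc j))) else 0)"
    if j: "Suc j \<le> K" for j
  proof -
    define p where "p = a + Suc j"
    define m where "m = K - Suc j"
    have m: "K - j = Suc m" using j unfolding m_def by simp
    \<comment> \<open>The right end of the outermost arc beside the cap; if \<open>m = 0\<close>,
      there is no such arc and \<open>s = p + 1\<close>.\<close>
    define s where "s = b - Suc j"
    have s: "s = p + 1 + 2 * m" "b - j = Suc s" unfolding s_def b_def p_def m_def using j by auto
    have lt: "p + 2 < s \<longleftrightarrow> Suc j < K" unfolding s m_def by auto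
    have "qint 2 * ?f (E (Suc j)) = ?f (E j) + (if p + 2 < s then ?f (E (Suc (Suc j))) else 0)"
    proof (rule contraction_step[OF jones_wenzl_killed_by_caps, where l = "a + j" and v = "b - j" and
          Y = "R \<union> (caps a b j \<union> caps (a + Suc j + 2) (b - Suc j) m)" and
          Z = "R \<union> (caps a b (Suc j) \<union> caps (a + Suc j + 3) (b - Suc (Suc j)) (m - 1))"])
      \<comment> \<open>The condition on the centre, \<open>a + k \<le> n\<close>, puts both ends of
        the cap \<open>{p, p + 1}\<close> among the lower points.\<close>
      show "p = Suc (a + j)" "p < n" using a j unfolding p_def k by auto
      show "E (Suc j) \<in> tl_diagrams n" "E j \<in> tl_diagrams n" using E(1) j by auto
      show "capform n (E (Suc j)) = insert {p, Suc p} (insert {a + j, b - j}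
          (R \<union> (caps a b j \<union> caps (a + Suc j + 2) (b - Suc j) m)))"
        using E(2)[OF j] stage_exchange_outer(1)[of a b j m] unfolding p_def m_def by simp
      show "capform n (E j) = insert {p, a + j} (insert {Suc p, b - j}
          (R \<union> (caps a b j \<union> caps (a + Suc j + 2) (b - Suc j) m)))"
        using E(2)[of j] j stage_exchange_outer(2)[of a b j m] unfolding p_def m by simp
      show "b - j = p + 2 \<and> s = Suc p \<or> b - j = Suc s \<and> p + 2 < s" unfolding s by auto
      assume "p + 2 < s"
      then have jK: "Suc (Suc j) \<le> K" using lt by simp
      then obtain m' where m': "m = Suc m'" "K - Suc (Suc j) = m'" unfolding m_def
        by (metis Suc_diff_Suc Suc_le_lessD)
      show "E (Suc (Suc j)) \<in> tl_diagrams n \<and>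
        capform n (E (Suc j)) = insert {p, Suc p} (insert {s, p + 2}
          (R \<union> (caps a b (Suc j) \<union> caps (a + Suc j + 3) (b - Suc (Suc j)) (m - 1)))) \<and>
        capform n (E (Suc (Suc j))) = insert {p, s} (insert {Suc p, p + 2}
          (R \<union> (caps a b (Suc j) \<union> caps (a + Suc j + 3) (b - Suc (Suc j)) (m - 1))))"
        using E(1)[OF jK] E(2)[OF j] E(2)[OF jK] stage_exchange_right[of a b "Suc j" m'] m'
        unfolding p_def s_def m_def by simp
    qed
    then show ?thesis unfolding lt .
  qed
  \<comment> \<open>The recursion runs backwards from \<open>D\<close>, with \<open>t\<close> the
    distance from it: the stage \<open>D\<close> has only one neighbour, which produces
    \<open>qint 2\<close>, and from there on two consecutive values determine the next.\<close>
  have "t \<le> K \<Longrightarrow> ?f (E (K - t)) = qint (Suc t) * ?f D" for t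
  proof (induction t rule: less_induct)
    case (less t)
    consider "t = 0" | "t = 1" | u where "t = Suc (Suc u)"
      by (metis One_nat_def old.nat.exhaust)
    then show ?case
    proof cases
      case 1
      then show ?thesis using EK by simp
    next
      case 2
      then have "Suc (K - 1) = K" using less.prems by simp
      then show ?thesis using step[of "K - 1"] less.prems 2 EK by (simp add: numeral_2_eq_2)
    next
      case 3
      have idx: "Suc (K - t) = K - Suc u" "Suc (K - Suc u) = K - u" "Suc (K - t) < K"
        using less.prems 3 by auto
      have "?f (E (K - t)) = qint 2 * ?f (E (K - Suc u)) - ?f (E (K - u))"
        using step[of "K - t"] less.prems idx 3 by simp
      also have "\<dots> = (qint 2 * qint (Suc (Suc u)) - qint (Suc u)) * ?f D"
        using less.IH[of u] less.IH[of "Suc u"] less.prems 3 by (simp add: algebra_simps)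
      finally show ?thesis using qint_Suc_Suc[of "Suc u"] 3 by simp
    qed
  qed
  from this[of K] show ?thesis using E0 k by simp
qed

end
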